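(* Let $n \ge 1$ and let $f:\{0,1\}^n \to \{0,1\}$ be a Boolean function of degree $d$. Then $f$ has at most $4.416 \cdot 2^d$ relevant variables.
   Context: Every function $f:\{0,1\}^n\to\{0,1\}$ agrees on $\{0,1\}^n$ with a unique multilinear polynomial in $\mathbb{R}[x_1,\dots,x_n]$; the degree $\deg(f)$ of $f$ is the degree of this polynomial. A variable $x_i$ is relevant for $f$ if it appears in some monomial with non-zero coefficient in this polynomial (equivalently, there is an input $x$ such that flipping the $i$-th bit of $x$ changes $f(x)$). *)

theory Defs
  imports Complex_Main
begin

text \<open>Boolean cube {0,1}^n: inputs are functions nat => bool, with bit i (i < n)
  being x i (True = 1), and all coordinates >= n fixed to False (irrelevant padding).\<close>
definition cube :: "nat \<Rightarrow> (nat \<Rightarrow> bool) set" where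
  "cube n = {x. \<forall>i\<ge>n. \<not> x i}"

definition multilinear_rep :: "nat \<Rightarrow> ((nat \<Rightarrow> bool) \<Rightarrow> bool) \<Rightarrow> (nat set \<Rightarrow> real) \<Rightarrow> bool" where
  "multilinear_rep n f c \<longleftrightarrow>
     (\<forall>S. \<not> S \<subseteq> {0..<n} \<longrightarrow> c S = 0) \<and>
     (\<forall>x\<in>cube n. of_bool (f x) = (\<Sum>S\<in>Pow {0..<n}. c S * (\<Prod>i\<in>S. of_bool (x i))))"

definition ml_coeffs :: "nat \<Rightarrow> ((nat \<Rightarrow> bool) \<Rightarrow> bool) \<Rightarrow> nat set \<Rightarrow> real" where
  "ml_coeffs n f = (THE c. multilinear_rep n f c)"

text \<open>Degree: maximal size of a monomial with nonzero coefficient (0 for the zero polynomial).\<close>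
definition bool_deg :: "nat \<Rightarrow> ((nat \<Rightarrow> bool) \<Rightarrow> bool) \<Rightarrow> nat" where
  "bool_deg n f = Max (insert 0 {card S | S. S \<subseteq> {0..<n} \<and> ml_coeffs n f S \<noteq> 0})"

definition relevant :: "nat \<Rightarrow> ((nat \<Rightarrow> bool) \<Rightarrow> bool) \<Rightarrow> nat \<Rightarrow> bool" where
  "relevant n f i \<longleftrightarrow> i < n \<and> (\<exists>x\<in>cube n. f (x(i := \<not> x i)) \<noteq> f x)"

end

theory Submission
  imports Defs "HOL-Computational_Algebra.Polynomial" "HOL-Library.Disjoint_Sets"
begin

text \<open>For a Boolean function $g$ let $W(g) = \sum_i 2^{-\deg_i g}$ over the relevant variables, where
  $\deg_i g$ is the largest degree of a monomial containing $i$; the number of relevant variables is at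
  most $2^d W(g)$. Two facts bound $W$. First, $2^{1-\deg_i g}$ is at most the influence of $i$, so
  $W(g) \le d/2$. Second, fixing the variables of a monomial $M$ of top degree $d$ in all possible ways
  (Chiarelli, Hatami, Saks) gives $W(g) \le d 2^{-d}$ plus the average of $W$ over the restrictions,
  and each restriction has smaller block sensitivity than $g$, since $M$ always contains a sensitive
  block. As block sensitivity is bounded by some $B_d$ in terms of the degree, at most
  $B_j$ such steps are made in degree at most $j$, and the total cost is at most about
  $4 + \sum_{j>8} j 2^{-j} (B_j - B_{j-1})$.

  Sharp values of $B_d$ come from univariate polynomials $p$ of degree at most $d$ with $p(0)=0$,
  $p(1)=1$ and values in $[0,1]$ at the integers up to the block sensitivity: a divided difference
  over $d+2$ well chosen integers vanishes on $p$, which is contradictory when the weight of the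
  node $1$ dominates. For large $d$ the bound $B_d < 2d^2$ suffices.\<close>

subsection \<open>Coefficients of the multilinear polynomial\<close>

lemma sum_Pow_insert:
  assumes "finite V" "j \<notin> V"
  shows "(\<Sum>A\<in>Pow (insert j V). F A) = (\<Sum>A\<in>Pow V. F A + F (insert j A))"
proof -
  have "inj_on (insert j) (Pow V)"
    using assms(2) by (auto simp: inj_on_def insert_eq_iff)
  moreover have "Pow V \<inter> insert j ` Pow V = {}"
    using assms(2) by auto
  ultimately show ?thesis
    using assms(1) by (simp add: Pow_insert sum.union_disjoint sum.reindex sum.distrib)
qed

text \<open>A point of the cube is encoded as the set of its ones. This is the coefficient of the
  monomial with variable set \<open>S\<close> in the multilinear polynomial of \<open>h\<close>, by
  Moebius inversion over subsets.\<close>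

definition coef :: "('a set \<Rightarrow> real) \<Rightarrow> 'a set \<Rightarrow> real" where
  "coef h S = (\<Sum>T\<in>Pow S. (-1) ^ card (S - T) * h T)"

lemma coef_empty [simp]: "coef h {} = h {}"
  by (simp add: coef_def)

lemma coef_cong: "(\<And>T. T \<subseteq> S \<Longrightarrow> h T = k T) \<Longrightarrow> coef h S = coef k S"
  by (auto simp: coef_def intro!: sum.cong)

lemma coef_add: "coef (\<lambda>X. h X + k X) S = coef h S + coef k S"
  by (simp add: coef_def sum.distrib distrib_left)

lemma coef_diff: "coef (\<lambda>X. h X - k X) S = coef h S - coef k S"
  by (simp add: coef_def sum_subtractf right_diff_distrib)

lemma coef_cmult: "coef (\<lambda>X. r * h X) S = r * coef h S"
  by (simp add: coef_def sum_distrib_left mult_ac)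

lemma coef_sum: "coef (\<lambda>X. \<Sum>i\<in>I. h i X) S = (\<Sum>i\<in>I. coef (h i) S)"
  by (induction I rule: infinite_finite_induct) (simp_all add: coef_add, simp_all add: coef_def)

lemma coef_insert:
  assumes "finite S" "j \<notin> S"
  shows "coef h (insert j S) = coef (\<lambda>X. h (insert j X)) S - coef h S"
proof -
  have *: "insert j S - T = insert j (S - T)" "insert j S - insert j T = S - T" if "T \<subseteq> S" for T
    using assms that by auto
  have "coef h (insert j S) = (\<Sum>T\<in>Pow S. (-1) ^ card (S - T) * h (insert j T) - (-1) ^ card (S - T) * h T)"
    unfolding coef_def sum_Pow_insert[OF assms] using assms
    by (intro sum.cong refl) (auto simp: *)
  then show ?thesis
    by (simp add: coef_def sum_subtractf)
qed

lemma coef_eq_0_if_independent: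
  assumes "finite S" "j \<in> S" "\<And>X. X \<subseteq> S - {j} \<Longrightarrow> h (insert j X) = h X"
  shows "coef h S = 0"
proof -
  have "coef (\<lambda>X. h (insert j X)) (S - {j}) = coef h (S - {j})"
    by (rule coef_cong) (use assms(3) in auto)
  then show ?thesis
    using coef_insert[of "S - {j}" j h] assms(1,2) by (simp add: insert_absorb)
qed

lemma coef_const: "finite S \<Longrightarrow> coef (\<lambda>X. r) S = (if S = {} then r else 0)"
  by (auto intro: coef_eq_0_if_independent)

text \<open>In the induction \<open>S\<close> and \<open>insert j S\<close> are grouped: their
  coefficients add up to the coefficient of \<open>S\<close> once the variable \<open>j\<close> is
  set to 1.\<close>

lemma moebius_inversion:
  assumes "finite A"
  shows "(\<Sum>S\<in>Pow A. coef h S) = h A"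
  using assms
proof (induction A arbitrary: h)
  case (insert j A)
  have "(\<Sum>S\<in>Pow (insert j A). coef h S) = (\<Sum>S\<in>Pow A. coef (\<lambda>X. h (insert j X)) S)"
    unfolding sum_Pow_insert[OF insert.hyps]
  proof (intro sum.cong refl)
    fix S assume "S \<in> Pow A"
    then have "finite S" "j \<notin> S"
      using insert.hyps finite_subset by auto
    then show "coef h S + coef h (insert j S) = coef (\<lambda>X. h (insert j X)) S"
      by (simp add: coef_insert)
  qed
  then show ?case
    by (simp add: insert.IH)
qed simp

lemma coef_unique:
  assumes "finite V" "\<And>A. A \<subseteq> V \<Longrightarrow> h A = (\<Sum>S\<in>Pow A. c S)" "S \<subseteq> V"
  shows "coef h S = c S"
proof -
  have "finite S"
    using assms finite_subset by blast
  then show ?thesis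
    using assms(3)
  proof (induction S rule: finite_psubset_induct)
    case (psubset S)
    have "(\<Sum>T\<in>Pow S. coef h T) = (\<Sum>T\<in>Pow S. c T)"
      using moebius_inversion[OF psubset.hyps] assms(2)[OF psubset.prems] by simp
    moreover have "(\<Sum>T\<in>Pow S - {S}. coef h T) = (\<Sum>T\<in>Pow S - {S}. c T)"
      using psubset by (intro sum.cong refl) auto
    ultimately show ?case
      using psubset.hyps by (simp add: sum_diff1)
  qed
qed

section \<open>Fixing one variable and differentiating in it\<close>

definition fix_False :: "'a \<Rightarrow> ('a set \<Rightarrow> real) \<Rightarrow> 'a set \<Rightarrow> real" where
  "fix_False j h = (\<lambda>X. h (X - {j}))"

definition fix_True :: "'a \<Rightarrow> ('a set \<Rightarrow> real) \<Rightarrow> 'a set \<Rightarrow> real" where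
  "fix_True j h = (\<lambda>X. h (insert j X))"

lemma coef_fix_False:
  assumes "finite S"
  shows "coef (fix_False j h) S = (if j \<in> S then 0 else coef h S)"
proof (cases "j \<in> S")
  case True
  then show ?thesis
    using assms by (auto intro!: coef_eq_0_if_independent[of _ j] simp: fix_False_def)
next
  case False
  then show ?thesis
    by (auto intro!: coef_cong simp: fix_False_def) (metis Diff_empty Diff_insert0 subset_iff)
qed

lemma coef_fix_True:
  assumes "finite S"
  shows "coef (fix_True j h) S = (if j \<in> S then 0 else coef h S + coef h (insert j S))"
  using assms
  by (auto simp: coef_insert fix_True_def intro!: coef_eq_0_if_independent[of _ j])

text \<open>Nonzero exactly at the inputs where flipping \<open>i\<close> changes \<open>h\<close>.
  Its monomials are those of \<open>h\<close> that contain \<open>i\<close>, with \<open>i\<close>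
  removed.\<close>

definition deriv_at :: "'a \<Rightarrow> ('a set \<Rightarrow> real) \<Rightarrow> 'a set \<Rightarrow> real" where
  "deriv_at i h = (\<lambda>X. h (insert i X) - h (X - {i}))"

lemma coef_deriv_at:
  assumes "finite S"
  shows "coef (deriv_at i h) S = (if i \<in> S then 0 else coef h (insert i S))"
proof -
  have "coef (deriv_at i h) S = coef (fix_True i h) S - coef (fix_False i h) S"
    by (simp add: deriv_at_def coef_diff fix_True_def fix_False_def)
  then show ?thesis
    using assms by (simp add: coef_fix_True coef_fix_False)
qed

subsection \<open>Degree weights and restrictions\<close>

definition degree_le :: "'a set \<Rightarrow> nat \<Rightarrow> ('a set \<Rightarrow> real) \<Rightarrow> bool" where
  "degree_le V d h \<longleftrightarrow> (\<forall>S\<subseteq>V. coef h S \<noteq> 0 \<longrightarrow> card S \<le> d)"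

text \<open>Applied to the derivative of $g$ at $i$ this is $2^{1-\deg_i g}$, where $\deg_i g$ is the largest
  degree of a monomial of $g$ that contains the variable $i$.\<close>
definition degree_weight :: "'a set \<Rightarrow> ('a set \<Rightarrow> real) \<Rightarrow> real" where
  "degree_weight V h = (if \<forall>S\<subseteq>V. coef h S = 0 then 0
     else (1/2) ^ Max {card S | S. S \<subseteq> V \<and> coef h S \<noteq> 0})"

lemma degree_weight_nonneg: "0 \<le> degree_weight V h"
  by (simp add: degree_weight_def)

lemma finite_coef_cards: "finite V \<Longrightarrow> finite {card S | S. S \<subseteq> V \<and> coef h S \<noteq> 0}"
  by (rule finite_subset[of _ "card ` Pow V"]) auto

lemma degree_weight_le:
  assumes "finite V" "S \<subseteq> V" "coef h S \<noteq> 0"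
  shows "degree_weight V h \<le> (1/2) ^ card S"
proof -
  have "card S \<le> Max {card S | S. S \<subseteq> V \<and> coef h S \<noteq> 0}"
    using assms by (intro Max_ge finite_coef_cards) auto
  then have "(1/2::real) ^ Max {card S | S. S \<subseteq> V \<and> coef h S \<noteq> 0} \<le> (1/2) ^ card S"
    by (intro power_decreasing) auto
  then show ?thesis
    by (simp add: degree_weight_def)
qed

lemma degree_weight_attained:
  assumes "finite V" "\<not> (\<forall>S\<subseteq>V. coef h S = 0)"
  obtains S where "S \<subseteq> V" "coef h S \<noteq> 0" "degree_weight V h = (1/2) ^ card S" "degree_le V (card S) h"
proof -
  have ne: "{card S | S. S \<subseteq> V \<and> coef h S \<noteq> 0} \<noteq> {}"
    using assms(2) by auto
  from Max_in[OF finite_coef_cards[OF assms(1)] ne]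
  obtain S where S: "S \<subseteq> V" "coef h S \<noteq> 0" "Max {card S | S. S \<subseteq> V \<and> coef h S \<noteq> 0} = card S"
    by auto
  moreover have "degree_le V (card S) h"
    unfolding degree_le_def S(3)[symmetric]
    by (auto intro!: Max_ge finite_coef_cards assms(1))
  ultimately show ?thesis
    using that assms(2) by (auto simp: degree_weight_def)
qed

lemma degree_weight_ge:
  assumes "finite V" "degree_le V d h" "\<not> (\<forall>S\<subseteq>V. coef h S = 0)"
  shows "(1/2) ^ d \<le> degree_weight V h"
proof -
  obtain S where S: "S \<subseteq> V" "coef h S \<noteq> 0" "degree_weight V h = (1/2) ^ card S"
    using degree_weight_attained[OF assms(1,3)] by blast
  then have "card S \<le> d"
    using assms(2) by (simp add: degree_le_def)
  then show ?thesis
    unfolding S(3) by (intro power_decreasing) auto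
qed

text \<open>If both restrictions are nonzero, neither exceeds the degree of \<open>h\<close>, so
  both weights are at least that of \<open>h\<close>. If one vanishes, \<open>h\<close> splits off a
  factor in \<open>j\<close> alone, so the other has smaller degree and at least twice the
  weight.\<close>

lemma degree_weight_fix:
  assumes "finite V" "j \<in> V"
  shows "degree_weight V h \<le> (degree_weight V (fix_False j h) + degree_weight V (fix_True j h)) / 2"
proof (cases "\<forall>S\<subseteq>V. coef h S = 0")
  case True
  then have "degree_weight V h = 0"
    by (simp add: degree_weight_def)
  then show ?thesis
    using degree_weight_nonneg[of V "fix_False j h"] degree_weight_nonneg[of V "fix_True j h"] by simp
next
  case False
  then obtain M where M: "M \<subseteq> V" "coef h M \<noteq> 0" "degree_weight V h = (1/2) ^ card M" "degree_le V (card M) h"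
    using degree_weight_attained[OF assms(1)] by blast
  have fin: "finite S" if "S \<subseteq> V" for S
    using that assms(1) finite_subset by blast
  note cF = coef_fix_False[OF fin, of _ j h] and cT = coef_fix_True[OF fin, of _ j h]
  have deg: "card S \<le> card M" if "S \<subseteq> V" "coef h S \<noteq> 0" for S
    using M(4) that by (auto simp: degree_le_def)
  define d where "d = card M"
  consider (both) "\<not> (\<forall>S\<subseteq>V. coef (fix_False j h) S = 0)" "\<not> (\<forall>S\<subseteq>V. coef (fix_True j h) S = 0)"
    | (F) "\<forall>S\<subseteq>V. coef (fix_False j h) S = 0"
    | (T) "\<forall>S\<subseteq>V. coef (fix_True j h) S = 0" "\<not> (\<forall>S\<subseteq>V. coef (fix_False j h) S = 0)"
    by blast
  then show ?thesis
  proof cases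
    case both
    have "degree_le V d (fix_False j h)"
      using deg by (auto simp: degree_le_def cF d_def split: if_splits)
    moreover have "degree_le V d (fix_True j h)"
      unfolding degree_le_def
    proof (intro allI impI)
      fix S assume S: "S \<subseteq> V" "coef (fix_True j h) S \<noteq> 0"
      then have "j \<notin> S" "coef h S \<noteq> 0 \<or> coef h (insert j S) \<noteq> 0"
        by (auto simp: cT split: if_splits)
      then show "card S \<le> d"
        using deg[of S] deg[of "insert j S"] S(1) assms(2) fin[OF S(1)] by (auto simp: d_def)
    qed
    ultimately show ?thesis
      using degree_weight_ge[OF assms(1) _ both(1), of d] degree_weight_ge[OF assms(1) _ both(2), of d] M(3)
      by (simp add: d_def)
  next
    \<comment> \<open>Now \<open>h\<close> is the other restriction multiplied by the variable
      \<open>j\<close>, so removing \<open>j\<close> from its monomials lowers the degree by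
      one.\<close>
    case F
    have z: "coef h S = 0" if "S \<subseteq> V" "j \<notin> S" for S
      using F that by (auto simp: cF)
    then have jM: "j \<in> M"
      using M(1,2) by blast
    have sub: "M - {j} \<subseteq> V"
      using M(1) by blast
    have "coef (fix_True j h) (M - {j}) = coef h M"
      using cT[OF sub] z[OF sub] jM by (simp add: insert_absorb)
    then have "coef (fix_True j h) (M - {j}) \<noteq> 0"
      using M(2) by simp
    then have nz: "\<not> (\<forall>S\<subseteq>V. coef (fix_True j h) S = 0)"
      using sub by blast
    have "degree_le V (d - 1) (fix_True j h)"
      unfolding degree_le_def
    proof (intro allI impI)
      fix S assume S: "S \<subseteq> V" "coef (fix_True j h) S \<noteq> 0"
      then have "j \<notin> S" "coef h (insert j S) \<noteq> 0"
        using z by (auto simp: cT split: if_splits)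
      then show "card S \<le> d - 1"
        using deg[of "insert j S"] S(1) assms(2) fin[OF S(1)] by (auto simp: d_def)
    qed
    from degree_weight_ge[OF assms(1) this nz]
    have "(1/2) ^ (d - 1) \<le> degree_weight V (fix_True j h)" .
    moreover have "d > 0"
      using jM fin[OF M(1)] by (auto simp: d_def card_gt_0_iff)
    ultimately show ?thesis
      using M(3) degree_weight_nonneg[of V "fix_False j h"] by (cases d) (auto simp: d_def)
  next
    \<comment> \<open>Now \<open>h\<close> is the other restriction times one minus the variable
      \<open>j\<close>: monomials pair up as \<open>S\<close> and \<open>insert j S\<close>, and the
      larger one keeps \<open>card S\<close> below \<open>d\<close>.\<close>
    case T
    have z: "coef h (insert j S) = - coef h S" if "S \<subseteq> V" "j \<notin> S" for S
    proof -
      have "coef (fix_True j h) S = 0"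
        using T(1) that(1) by blast
      then show ?thesis
        using cT[OF that(1)] that(2) by simp
    qed
    have small: "card S < d" if "S \<subseteq> V" "coef (fix_False j h) S \<noteq> 0" for S
    proof -
      have "j \<notin> S" "coef h S \<noteq> 0"
        using that by (auto simp: cF split: if_splits)
      then show ?thesis
        using deg[of "insert j S"] z[of S] that assms(2) fin[OF that(1)] by (auto simp: d_def)
    qed
    have "degree_le V (d - 1) (fix_False j h)"
      unfolding degree_le_def
    proof (intro allI impI)
      fix S assume "S \<subseteq> V" "coef (fix_False j h) S \<noteq> 0"
      from small[OF this] show "card S \<le> d - 1"
        by simp
    qed
    from degree_weight_ge[OF assms(1) this T(2)]
    have "(1/2) ^ (d - 1) \<le> degree_weight V (fix_False j h)" .
    moreover obtain S where "S \<subseteq> V" "coef (fix_False j h) S \<noteq> 0"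
      using T(2) by blast
    then have "d > 0"
      using small[of S] by simp
    ultimately show ?thesis
      using M(3) degree_weight_nonneg[of V "fix_True j h"] by (cases d) (auto simp: d_def)
  qed
qed

section \<open>Fixing a set of variables\<close>

definition restrict_to :: "'a set \<Rightarrow> 'a set \<Rightarrow> ('a set \<Rightarrow> real) \<Rightarrow> 'a set \<Rightarrow> real" where
  "restrict_to M \<alpha> h = (\<lambda>X. h ((X - M) \<union> \<alpha>))"

lemma restrict_to_insert:
  assumes "\<alpha> \<subseteq> M" "j \<notin> M"
  shows "restrict_to (insert j M) \<alpha> h = restrict_to M \<alpha> (fix_False j h)"
    and "restrict_to (insert j M) (insert j \<alpha>) h = restrict_to M \<alpha> (fix_True j h)"
proof -
  have "X - insert j M \<union> \<alpha> = X - M \<union> \<alpha> - {j}" "X - insert j M \<union> insert j \<alpha> = insert j (X - M \<union> \<alpha>)" for X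
    using assms by auto
  then show "restrict_to (insert j M) \<alpha> h = restrict_to M \<alpha> (fix_False j h)"
    "restrict_to (insert j M) (insert j \<alpha>) h = restrict_to M \<alpha> (fix_True j h)"
    by (simp_all add: restrict_to_def fix_False_def fix_True_def)
qed

text \<open>One application of \<open>degree_weight_fix\<close> per variable of \<open>M\<close>.
  Restricted functions stay functions on all of \<open>V\<close> that ignore \<open>M\<close>, so
  the ground set never changes.\<close>

lemma degree_weight_restrict_to:
  assumes "finite V" "M \<subseteq> V"
  shows "degree_weight V h \<le> (1/2) ^ card M * (\<Sum>\<alpha>\<in>Pow M. degree_weight V (restrict_to M \<alpha> h))"
proof -
  have "finite M"
    using assms finite_subset by blast
  then show ?thesis
    using assms(2)
  proof (induction M arbitrary: h)
    case empty
    show ?case by (simp add: restrict_to_def)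
  next
    case (insert j M)
    have "(\<Sum>\<alpha>\<in>Pow (insert j M). degree_weight V (restrict_to (insert j M) \<alpha> h))
        = (\<Sum>\<alpha>\<in>Pow M. degree_weight V (restrict_to M \<alpha> (fix_False j h)))
          + (\<Sum>\<alpha>\<in>Pow M. degree_weight V (restrict_to M \<alpha> (fix_True j h)))"
      unfolding sum_Pow_insert[OF insert.hyps] sum.distrib[symmetric]
      using insert.hyps by (intro sum.cong refl) (simp add: restrict_to_insert)
    moreover have "degree_weight V h \<le> (degree_weight V (fix_False j h) + degree_weight V (fix_True j h)) / 2"
      using degree_weight_fix[OF assms(1)] insert.prems by blast
    ultimately show ?case
      using insert.IH[of "fix_False j h"] insert.IH[of "fix_True j h"] insert.prems insert.hyps
      by (simp add: algebra_simps)
  qed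
qed

text \<open>Setting a variable to 0 deletes monomials; setting it to 1 merges a monomial with the
  one that is larger by that variable.\<close>

lemma degree_le_restrict_to:
  assumes "finite V" "M \<subseteq> V" "\<alpha> \<subseteq> M" "degree_le V d h"
  shows "degree_le V d (restrict_to M \<alpha> h)"
proof -
  have "finite M"
    using assms finite_subset by blast
  then show ?thesis
    using assms(2-4)
  proof (induction M arbitrary: h \<alpha>)
    case empty
    then show ?case by (simp add: restrict_to_def)
  next
    case (insert j M)
    have fin: "finite S" if "S \<subseteq> V" for S
      using that assms(1) finite_subset by blast
    have F: "degree_le V d (fix_False j h)"
      using insert.prems(3) by (auto simp: degree_le_def coef_fix_False fin)
    have T: "degree_le V d (fix_True j h)"
      unfolding degree_le_def
    proof (intro allI impI)
      fix S assume S: "S \<subseteq> V" "coef (fix_True j h) S \<noteq> 0"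
      then have "coef h S \<noteq> 0 \<or> coef h (insert j S) \<noteq> 0"
        by (auto simp: coef_fix_True fin split: if_splits)
      then have "card S \<le> d \<or> card (insert j S) \<le> d"
        using insert.prems S(1) by (auto simp: degree_le_def)
      then show "card S \<le> d"
        using card_insert_le[of S j] by linarith
    qed
    show ?case
    proof (cases "j \<in> \<alpha>")
      case True
      then have \<alpha>: "\<alpha> = insert j (\<alpha> - {j})" "\<alpha> - {j} \<subseteq> M"
        using insert.prems by auto
      show ?thesis
        using insert.IH[OF _ \<alpha>(2) T] restrict_to_insert(2)[OF \<alpha>(2) insert.hyps(2), of h] insert.prems \<alpha>(1)
        by simp
    next
      case False
      then have \<alpha>: "\<alpha> \<subseteq> M"
        using insert.prems by auto
      show ?thesis
        using insert.IH[OF _ \<alpha> F] restrict_to_insert(1)[OF \<alpha> insert.hyps(2), of h] insert.prems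
        by simp
    qed
  qed
qed

subsection \<open>Influences and the weight of a Boolean function\<close>

text \<open>Poincare-type inequality behind ``total influence is at most the degree''. The bound is
  $4(e-1)$ for a function whose coefficients vanish from size $e$ on (rather than $4d$ for degree $d$),
  so that $e = 0$ covers the zero function and the induction can pass from $e$ to $e - 1$ for the
  odd part of $h$ in the variable $j$.\<close>
lemma dirichlet_form_le:
  assumes "finite V" "\<And>S. S \<subseteq> V \<Longrightarrow> e \<le> card S \<Longrightarrow> coef h S = 0"
  shows "(\<Sum>i\<in>V. \<Sum>A\<in>Pow V. (deriv_at i h A)\<^sup>2) \<le> 4 * (real e - 1) * (\<Sum>A\<in>Pow V. (h A)\<^sup>2)"
  using assms
proof (induction V arbitrary: h e)
  case empty
  then show ?case
    using empty.prems[of "{}"] by (cases e) auto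
next
  case (insert j V)
  \<comment> \<open>The even and odd parts of \<open>h\<close> in the variable \<open>j\<close>. The
    coefficients of \<open>b\<close> come from monomials that also contain \<open>j\<close>, so they
    vanish already from size \<open>e - 1\<close> on.\<close>
  define a b where "a = (\<lambda>X. 1/2 * (h X + h (insert j X)))" and "b = (\<lambda>X. 1/2 * (h X - h (insert j X)))"
  define Q where "Q k = (\<Sum>i\<in>V. \<Sum>A\<in>Pow V. (deriv_at i k A)\<^sup>2)" for k
  define E where "E k = (\<Sum>A\<in>Pow V. (k A)\<^sup>2)" for k :: "'a set \<Rightarrow> real"
  have fin: "finite S" if "S \<subseteq> V" for S
    using that insert.hyps finite_subset by blast
  have ins: "coef (\<lambda>X. h (insert j X)) S = coef h S + coef h (insert j S)" if "S \<subseteq> V" for S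
  proof -
    have "j \<notin> S"
      using that insert.hyps by auto
    then show ?thesis
      using coef_insert[OF fin[OF that], of j h] by simp
  qed
  have coef_a: "coef a S = coef h S + coef h (insert j S) / 2" if "S \<subseteq> V" for S
    unfolding a_def coef_cmult coef_add using ins[OF that] by simp
  have coef_b: "coef b S = - coef h (insert j S) / 2" if "S \<subseteq> V" for S
    unfolding b_def coef_cmult coef_diff using ins[OF that] by simp
  have card_ins: "card (insert j S) = Suc (card S)" if "S \<subseteq> V" for S
  proof -
    have "j \<notin> S"
      using that insert.hyps by auto
    then show ?thesis
      using fin[OF that] by simp
  qed
  have Qa: "Q a \<le> 4 * (real e - 1) * E a"
    unfolding Q_def E_def
  proof (rule insert.IH)
    fix S assume S: "S \<subseteq> V" "e \<le> card S"
    then have "coef h S = 0" "coef h (insert j S) = 0"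
      using insert.prems[of S] insert.prems[of "insert j S"] card_ins[OF S(1)]
      by (simp_all add: subset_insertI2 insert_mono)
    then show "coef a S = 0"
      using coef_a[OF S(1)] by simp
  qed
  have Qb: "Q b \<le> 4 * (real (e - 1) - 1) * E b"
    unfolding Q_def E_def
  proof (rule insert.IH)
    fix S assume S: "S \<subseteq> V" "e - 1 \<le> card S"
    then have "coef h (insert j S) = 0"
      using insert.prems[of "insert j S"] card_ins[OF S(1)] by (simp add: subset_insertI2)
    then show "coef b S = 0"
      using coef_b[OF S(1)] by simp
  qed
  have pos: "Q b \<ge> 0" "E a \<ge> 0" "E b \<ge> 0"
    by (auto simp: Q_def E_def intro!: sum_nonneg)
  have h_split: "(h A)\<^sup>2 + (h (insert j A))\<^sup>2 = 2 * ((a A)\<^sup>2 + (b A)\<^sup>2)" for A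
    by (simp add: a_def b_def power2_eq_square algebra_simps)
  have norm: "(\<Sum>A\<in>Pow (insert j V). (h A)\<^sup>2) = 2 * (E a + E b)"
    unfolding sum_Pow_insert[OF insert.hyps] h_split E_def
    by (simp add: sum_distrib_left sum.distrib)
  have deriv_split: "(deriv_at i h A)\<^sup>2 + (deriv_at i h (insert j A))\<^sup>2 = 2 * ((deriv_at i a A)\<^sup>2 + (deriv_at i b A)\<^sup>2)"
    if "i \<in> V" for i A
  proof -
    have "insert i (insert j A) = insert j (insert i A)" "insert j A - {i} = insert j (A - {i})"
      using that insert.hyps by auto
    then show ?thesis
      by (simp add: deriv_at_def a_def b_def power2_eq_square algebra_simps)
  qed
  \<comment> \<open>For \<open>A\<close> without \<open>j\<close>, the derivative in
    \<open>j\<close> is \<open>- 2 * b A\<close> at both \<open>A\<close> and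
    \<open>insert j A\<close>.\<close>
  have "(\<Sum>A\<in>Pow (insert j V). (deriv_at j h A)\<^sup>2) = (\<Sum>A\<in>Pow V. 8 * (b A)\<^sup>2)"
    unfolding sum_Pow_insert[OF insert.hyps]
  proof (intro sum.cong refl)
    fix A assume "A \<in> Pow V"
    then have "A - {j} = A"
      using insert.hyps by auto
    then show "(deriv_at j h A)\<^sup>2 + (deriv_at j h (insert j A))\<^sup>2 = 8 * (b A)\<^sup>2"
      by (simp add: deriv_at_def b_def power2_eq_square algebra_simps)
  qed
  moreover have "(\<Sum>i\<in>V. \<Sum>A\<in>Pow (insert j V). (deriv_at i h A)\<^sup>2) = 2 * (Q a + Q b)"
    unfolding sum_Pow_insert[OF insert.hyps] Q_def
    by (simp add: deriv_split sum_distrib_left sum.distrib distrib_left)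
  ultimately have form: "(\<Sum>i\<in>insert j V. \<Sum>A\<in>Pow (insert j V). (deriv_at i h A)\<^sup>2) = 2 * (Q a + Q b + 4 * E b)"
    using insert.hyps by (simp add: E_def sum_distrib_left)
  have "Q a + Q b + 4 * E b \<le> 4 * (real e - 1) * (E a + E b)"
  proof (cases e)
    \<comment> \<open>Here \<open>e - 1\<close> truncates to 0; as \<open>Q b\<close> is
      nonnegative, its bound forces \<open>E b = 0\<close>.\<close>
    case 0
    then show ?thesis
      using Qa Qb pos by (simp add: algebra_simps)
  next
    case (Suc e')
    then show ?thesis
      using Qa Qb by (simp add: algebra_simps)
  qed
  then show ?case
    unfolding form norm by (simp add: algebra_simps)
qed

definition boolean_on :: "'a set \<Rightarrow> ('a set \<Rightarrow> real) \<Rightarrow> bool" where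
  "boolean_on V g \<longleftrightarrow> (\<forall>A\<subseteq>V. g A \<in> {0, 1})"

text \<open>This is $W(g)$: halving turns the weight of the derivative into $2^{-deg_i g}$, and an
  irrelevant variable contributes 0.\<close>

definition total_weight :: "'a set \<Rightarrow> ('a set \<Rightarrow> real) \<Rightarrow> real" where
  "total_weight V g = (\<Sum>i\<in>V. degree_weight V (deriv_at i g)) / 2"

text \<open>With all variables fixed, each restriction is a constant, of weight 1 if nonzero and 0
  otherwise. For a derivative the right side is the influence of the variable.\<close>

lemma degree_weight_le_support:
  assumes "finite V"
  shows "degree_weight V h \<le> (1/2) ^ card V * (\<Sum>A\<in>Pow V. of_bool (h A \<noteq> 0))"
proof -
  have "degree_weight V (restrict_to V A h) \<le> of_bool (h A \<noteq> 0)" if "A \<subseteq> V" for A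
  proof -
    have c: "coef (restrict_to V A h) S = (if S = {} then h A else 0)" if "S \<subseteq> V" for S
    proof -
      have "coef (restrict_to V A h) S = coef (\<lambda>_. h A) S"
        using that by (intro coef_cong) (auto simp: restrict_to_def Diff_eq_empty_iff[THEN iffD2])
      then show ?thesis
        using coef_const finite_subset[OF that assms] by metis
    qed
    show ?thesis
    proof (cases "h A = 0")
      case True
      then show ?thesis
        using c by (simp add: degree_weight_def)
    next
      case False
      then have "coef (restrict_to V A h) {} \<noteq> 0"
        using c[of "{}"] by simp
      from degree_weight_le[OF assms empty_subsetI this] show ?thesis
        using False by simp
    qed
  qed
  then have "(\<Sum>A\<in>Pow V. degree_weight V (restrict_to V A h)) \<le> (\<Sum>A\<in>Pow V. of_bool (h A \<noteq> 0))"
    by (intro sum_mono) auto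
  then show ?thesis
    using degree_weight_restrict_to[OF assms order_refl, of h]
    by (smt (verit) mult_left_mono zero_le_power divide_nonneg_nonneg)
qed

lemma total_weight_le_half_degree:
  assumes "finite V" "boolean_on V g" "degree_le V d g"
  shows "total_weight V g \<le> d / 2"
proof -
  \<comment> \<open>The sign version of \<open>g\<close> has square 1, and its squared derivative is
    4 exactly at the sensitive inputs, so its Dirichlet form measures the total influence.\<close>
  define F where "F = (\<lambda>X. 2 * g X - 1)"
  have sq: "of_bool (deriv_at i g A \<noteq> 0) = (deriv_at i F A)\<^sup>2 / 4" if "i \<in> V" "A \<subseteq> V" for i A
  proof -
    have "insert i A \<subseteq> V" "A - {i} \<subseteq> V"
      using that by auto
    then have "g (insert i A) \<in> {0, 1}" "g (A - {i}) \<in> {0, 1}"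
      using assms(2) unfolding boolean_on_def by blast+
    then show ?thesis
      unfolding F_def deriv_at_def by (elim insertE emptyE) (simp_all add: power2_eq_square)
  qed
  have "(\<Sum>i\<in>V. \<Sum>A\<in>Pow V. (deriv_at i F A)\<^sup>2) \<le> 4 * (real (Suc d) - 1) * (\<Sum>A\<in>Pow V. (F A)\<^sup>2)"
  proof (rule dirichlet_form_le[OF assms(1)])
    fix S assume S: "S \<subseteq> V" "Suc d \<le> card S"
    then have "coef g S = 0" "S \<noteq> {}" "finite S"
      using assms finite_subset by (auto simp: degree_le_def)
    then show "coef F S = 0"
      by (simp add: F_def coef_diff coef_cmult coef_const)
  qed
  also have "(\<Sum>A\<in>Pow V. (F A)\<^sup>2) = (\<Sum>A\<in>Pow V. 1)"
    using assms(2) by (intro sum.cong refl) (auto simp: F_def boolean_on_def)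
  finally have Q: "(\<Sum>i\<in>V. \<Sum>A\<in>Pow V. (deriv_at i F A)\<^sup>2) \<le> 4 * real d * 2 ^ card V"
    using assms(1) by (simp add: card_Pow)
  have "(\<Sum>i\<in>V. degree_weight V (deriv_at i g))
      \<le> (\<Sum>i\<in>V. (1/2) ^ card V * (\<Sum>A\<in>Pow V. of_bool (deriv_at i g A \<noteq> 0)))"
    by (intro sum_mono degree_weight_le_support assms)
  also have "\<dots> = (\<Sum>i\<in>V. (1/2) ^ card V * (\<Sum>A\<in>Pow V. (deriv_at i F A)\<^sup>2 / 4))"
    by (simp add: sq)
  also have "\<dots> = (1/2) ^ card V / 4 * (\<Sum>i\<in>V. \<Sum>A\<in>Pow V. (deriv_at i F A)\<^sup>2)"
    by (simp add: sum_distrib_left sum_divide_distrib)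
  also have "\<dots> \<le> (1/2) ^ card V / 4 * (4 * real d * 2 ^ card V)"
    using Q by (intro mult_left_mono) auto
  also have "\<dots> = d"
    by (simp add: power_one_over)
  finally show ?thesis
    by (simp add: total_weight_def)
qed

lemma deriv_at_restrict_to:
  assumes "i \<notin> M" "\<alpha> \<subseteq> M"
  shows "deriv_at i (restrict_to M \<alpha> h) = restrict_to M \<alpha> (deriv_at i h)"
proof -
  have "insert i X - M \<union> \<alpha> = insert i (X - M \<union> \<alpha>)" "X - {i} - M \<union> \<alpha> = X - M \<union> \<alpha> - {i}" for X
    using assms by auto
  then show ?thesis
    by (simp add: deriv_at_def restrict_to_def)
qed

text \<open>Each variable of \<open>M\<close> lies in the monomial \<open>M\<close> itself, so
  together these contribute at most \<open>card M / 2 ^ card M\<close>. Outside \<open>M\<close>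
  derivative and restriction commute, and the weight is at most the average over the
  restrictions.\<close>

lemma total_weight_restrict_to:
  assumes "finite V" "M \<subseteq> V" "coef g M \<noteq> 0"
  shows "total_weight V g \<le> card M / 2 ^ card M + (1/2) ^ card M * (\<Sum>\<alpha>\<in>Pow M. total_weight V (restrict_to M \<alpha> g))"
proof -
  define w where "w i = degree_weight V (deriv_at i g)" for i
  have finM: "finite M"
    using assms finite_subset by blast
  have "w i \<le> (1/2) ^ (card M - 1)" if "i \<in> M" for i
  proof -
    have "coef (deriv_at i g) (M - {i}) \<noteq> 0"
      using that finM assms(3) by (simp add: coef_deriv_at insert_absorb)
    then show ?thesis
      using degree_weight_le[OF assms(1), of "M - {i}" "deriv_at i g"] assms(2) that finM
      by (auto simp: w_def)
  qed
  then have "(\<Sum>i\<in>M. w i) \<le> (\<Sum>i\<in>M. (1/2) ^ (card M - 1))"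
    by (intro sum_mono)
  also have "\<dots> = 2 * (card M / 2 ^ card M)"
    by (cases "card M") (auto simp: power_one_over field_simps)
  finally have inside: "(\<Sum>i\<in>M. w i) \<le> 2 * (card M / 2 ^ card M)" .
  have "(\<Sum>i\<in>V - M. w i) \<le> (\<Sum>i\<in>V - M. (1/2) ^ card M * (\<Sum>\<alpha>\<in>Pow M. degree_weight V (restrict_to M \<alpha> (deriv_at i g))))"
    unfolding w_def by (intro sum_mono degree_weight_restrict_to assms)
  also have "\<dots> = (\<Sum>i\<in>V - M. (1/2) ^ card M * (\<Sum>\<alpha>\<in>Pow M. degree_weight V (deriv_at i (restrict_to M \<alpha> g))))"
    by (intro sum.cong refl arg_cong2[where f="(*)"]) (auto simp: deriv_at_restrict_to)
  also have "\<dots> = (1/2) ^ card M * (\<Sum>\<alpha>\<in>Pow M. \<Sum>i\<in>V - M. degree_weight V (deriv_at i (restrict_to M \<alpha> g)))"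
    by (simp add: sum_distrib_left sum.swap[of _ "Pow M"])
  also have "\<dots> \<le> (1/2) ^ card M * (\<Sum>\<alpha>\<in>Pow M. 2 * total_weight V (restrict_to M \<alpha> g))"
    unfolding total_weight_def using assms(1)
    by (intro mult_left_mono sum_mono) (auto intro!: sum_mono2 degree_weight_nonneg)
  finally have outside: "(\<Sum>i\<in>V - M. w i) \<le> 2 * ((1/2) ^ card M * (\<Sum>\<alpha>\<in>Pow M. total_weight V (restrict_to M \<alpha> g)))"
    by (simp add: sum_distrib_left mult_ac)
  have "(\<Sum>i\<in>V. w i) = (\<Sum>i\<in>V - M. w i) + (\<Sum>i\<in>M. w i)"
    by (rule sum.subset_diff[OF assms(2,1)])
  then have "(\<Sum>i\<in>V. w i) \<le> 2 * (card M / 2 ^ card M + (1/2) ^ card M * (\<Sum>\<alpha>\<in>Pow M. total_weight V (restrict_to M \<alpha> g)))"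
    using inside outside by (simp only: distrib_left)
  then show ?thesis
    unfolding total_weight_def[of V g] w_def by argo
qed

subsection \<open>Block sensitivity\<close>

text \<open>Flipping a block is symmetric difference. A sensitive block is automatically nonempty,
  so the disjoint blocks are also distinct.\<close>

definition sensitive_blocks :: "'a set \<Rightarrow> ('a set \<Rightarrow> real) \<Rightarrow> 'a set \<Rightarrow> (nat \<Rightarrow> 'a set) \<Rightarrow> nat \<Rightarrow> bool" where
  "sensitive_blocks V g A B b \<longleftrightarrow> A \<subseteq> V \<and> (\<forall>k<b. B k \<subseteq> V \<and> g (sym_diff A (B k)) \<noteq> g A)
     \<and> disjoint_family_on B {..<b}"

definition block_sensitivity_le :: "'a set \<Rightarrow> nat \<Rightarrow> ('a set \<Rightarrow> real) \<Rightarrow> bool" where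
  "block_sensitivity_le V b g \<longleftrightarrow> (\<forall>A B k. sensitive_blocks V g A B k \<longrightarrow> k \<le> b)"

lemma coef_union_right:
  assumes "finite T" "finite M" "M \<inter> T = {}"
  shows "coef (\<lambda>X. h (X \<union> T)) M = (\<Sum>U\<in>Pow T. coef h (M \<union> U))"
  using assms
proof (induction T arbitrary: h)
  case (insert j T)
  have "coef (\<lambda>X. h (X \<union> insert j T)) M = coef (\<lambda>X. (\<lambda>Y. h (insert j Y)) (X \<union> T)) M"
    by simp
  also have "\<dots> = (\<Sum>U\<in>Pow T. coef (\<lambda>Y. h (insert j Y)) (M \<union> U))"
    using insert by (intro insert.IH) auto
  also have "\<dots> = (\<Sum>U\<in>Pow T. coef h (M \<union> U) + coef h (M \<union> insert j U))"
  proof (intro sum.cong refl)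
    fix U assume "U \<in> Pow T"
    then have "finite (M \<union> U)" "j \<notin> M \<union> U"
      using insert.hyps insert.prems finite_subset by auto
    then show "coef (\<lambda>Y. h (insert j Y)) (M \<union> U) = coef h (M \<union> U) + coef h (M \<union> insert j U)"
      using coef_insert[of "M \<union> U" j h] by simp
  qed
  finally show ?case
    by (simp add: sum_Pow_insert insert.hyps)
qed simp

text \<open>With the outer variables set by \<open>T\<close>, the coefficient of \<open>M\<close> is
  the sum of all \<open>coef g (M \<union> U)\<close> with \<open>U \<subseteq> T\<close>.
  Maximality of the degree leaves only \<open>U = {}\<close>, so it is nonzero, whereas a constant
  has coefficient 0 at the nonempty \<open>M\<close>.\<close>

lemma top_monomial_sensitive:
  assumes "finite V" "degree_le V (card M) g" "M \<subseteq> V" "coef g M \<noteq> 0" "M \<noteq> {}" "T \<subseteq> V - M"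
  shows "\<exists>\<beta>\<subseteq>M. g (\<beta> \<union> T) \<noteq> r"
proof (rule ccontr)
  assume *: "\<not> (\<exists>\<beta>\<subseteq>M. g (\<beta> \<union> T) \<noteq> r)"
  have fin: "finite M" "finite T"
    using finite_subset[OF assms(3,1)] finite_subset[OF assms(6)] assms(1) by auto
  have "coef (\<lambda>X. g (X \<union> T)) M = coef (\<lambda>X. r) M"
    by (rule coef_cong) (use * in auto)
  also have "\<dots> = 0"
    using assms fin by (simp add: coef_const)
  moreover have "M \<inter> T = {}"
    using assms(6) by blast
  ultimately have "0 = (\<Sum>U\<in>Pow T. coef g (M \<union> U))"
    using coef_union_right[of T M g] fin by simp
  also have "\<dots> = (\<Sum>U\<in>{{}}. coef g (M \<union> U))"
  proof (rule sum.mono_neutral_right)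
    show "\<forall>U\<in>Pow T - {{}}. coef g (M \<union> U) = 0"
    proof
      fix U assume U: "U \<in> Pow T - {{}}"
      then have "finite U" "U \<noteq> {}" "M \<inter> U = {}"
        using finite_subset[of U T] fin(2) assms(6) by auto
      then have "card (M \<union> U) > card M"
        using fin by (simp add: card_Un_disjoint card_gt_0_iff)
      moreover have "M \<union> U \<subseteq> V"
        using assms(3,6) U by auto
      ultimately show "coef g (M \<union> U) = 0"
        using assms(2) unfolding degree_le_def by (meson not_less)
    qed
  qed (use fin in auto)
  finally show False
    using assms(4) by simp
qed

text \<open>Whatever the other variables are, $g$ is not constant on the subcube of a monomial $M$ of top
  degree, so $M$ contains one more sensitive block disjoint from those of the restricted function.\<close>
lemma block_sensitivity_restrict_to:
  assumes "finite V" "degree_le V (card M) g" "M \<subseteq> V" "coef g M \<noteq> 0" "M \<noteq> {}" "\<alpha> \<subseteq> M"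
    and "block_sensitivity_le V b g"
  shows "block_sensitivity_le V (b - 1) (restrict_to M \<alpha> g)" and "b > 0"
proof -
  have key: "k < b" if "sensitive_blocks V (restrict_to M \<alpha> g) A B k" for A B k
  proof -
    \<comment> \<open>The input at which \<open>g\<close> is evaluated when the restricted function
      is applied to \<open>A\<close>.\<close>
    define A' where "A' = A - M \<union> \<alpha>"
    have AV: "A \<subseteq> V" and B: "\<And>l. l < k \<Longrightarrow> B l \<subseteq> V" "disjoint_family_on B {..<k}"
      and sens: "\<And>l. l < k \<Longrightarrow> restrict_to M \<alpha> g (sym_diff A (B l)) \<noteq> restrict_to M \<alpha> g A"
      using that by (auto simp: sensitive_blocks_def)
    obtain \<beta> where \<beta>: "\<beta> \<subseteq> M" "g (\<beta> \<union> (A - M)) \<noteq> g A'"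
      using top_monomial_sensitive[OF assms(1-5), of "A - M" "g A'"] AV by auto
    \<comment> \<open>The old blocks act outside \<open>M\<close> as before; the new one, inside
      \<open>M\<close>, turns the assignment \<open>\<alpha>\<close> into
      \<open>\<beta>\<close>.\<close>
    define B' where "B' l = (if l < k then B l - M else sym_diff \<alpha> \<beta>)" for l
    have "sensitive_blocks V g A' B' (Suc k)"
      unfolding sensitive_blocks_def
    proof (intro conjI allI impI)
      show "A' \<subseteq> V"
        using AV assms by (auto simp: A'_def)
      fix l assume l: "l < Suc k"
      show "B' l \<subseteq> V"
        using l B(1)[of l] \<beta>(1) assms by (auto simp: B'_def)
      show "g (sym_diff A' (B' l)) \<noteq> g A'"
      proof (cases "l < k")
        case True
        then have "sym_diff A' (B' l) = sym_diff A (B l) - M \<union> \<alpha>"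
          using assms(6) by (auto simp: A'_def B'_def)
        then show ?thesis
          using sens[OF True] by (simp add: restrict_to_def A'_def)
      next
        case False
        then have "sym_diff A' (B' l) = \<beta> \<union> (A - M)"
          using assms(6) \<beta>(1) by (auto simp: A'_def B'_def)
        then show ?thesis
          using \<beta>(2) by simp
      qed
    next
      show "disjoint_family_on B' {..<Suc k}"
        using B(2) assms(6) \<beta>(1)
        by (auto simp: disjoint_family_on_def B'_def less_Suc_eq split: if_splits)
    qed
    then show "k < b"
      using assms(7) by (fastforce simp: block_sensitivity_le_def)
  qed
  then show "block_sensitivity_le V (b - 1) (restrict_to M \<alpha> g)"
    by (fastforce simp: block_sensitivity_le_def)
  have "sensitive_blocks V (restrict_to M \<alpha> g) {} (\<lambda>_. {}) 0"
    by (simp add: sensitive_blocks_def disjoint_family_on_def)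
  then show "b > 0"
    using key by blast
qed

subsection \<open>Univariate polynomials from sensitive blocks\<close>

definition choose_poly :: "nat \<Rightarrow> real poly" where
  "choose_poly s = smult (1 / fact s) (\<Prod>i<s. [:- real i, 1:])"

lemma degree_choose_poly: "degree (choose_poly s) \<le> s"
proof -
  have "degree (\<Prod>i<s. [:- real i, 1:]) \<le> (\<Sum>i<s. degree [:- real i, 1:])"
    using degree_prod_sum_le[of "{..<s}" "\<lambda>i. [:- real i, 1:]"] by (simp add: o_def)
  then show ?thesis
    by (simp add: choose_poly_def)
qed

lemma poly_choose_poly: "poly (choose_poly s) (real k) = real (k choose s)"
  by (simp add: choose_poly_def poly_prod binomial_gbinomial gbinomial_prod_rev lessThan_atLeast0)

lemma card_supersets_of_size:
  assumes "finite U" "S \<subseteq> U"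
  shows "card {K. K \<subseteq> U \<and> card K = k \<and> S \<subseteq> K} = (if card S \<le> k then (card U - card S) choose (k - card S) else 0)"
proof (cases "card S \<le> k")
  case True
  have finS: "finite S"
    using assms finite_subset by blast
  have "bij_betw (\<lambda>K. K - S) {K. K \<subseteq> U \<and> card K = k \<and> S \<subseteq> K} {K. K \<subseteq> U - S \<and> card K = k - card S}"
  proof (rule bij_betw_byWitness[where f' = "\<lambda>K. K \<union> S"])
    show "(\<lambda>K. K \<union> S) ` {K. K \<subseteq> U - S \<and> card K = k - card S} \<subseteq> {K. K \<subseteq> U \<and> card K = k \<and> S \<subseteq> K}"
    proof (clarify, intro conjI)
      fix K assume K: "K \<subseteq> U - S" "card K = k - card S"
      then have "finite K" "K \<inter> S = {}"
        using finite_subset[of K U] assms by auto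
      then show "card (K \<union> S) = k"
        using K finS True by (simp add: card_Un_disjoint)
    qed (use assms in auto)
  qed (use finS in \<open>auto simp: card_Diff_subset\<close>)
  then have "card {K. K \<subseteq> U \<and> card K = k \<and> S \<subseteq> K} = card {K. K \<subseteq> U - S \<and> card K = k - card S}"
    by (rule bij_betw_same_card)
  also have "\<dots> = (card U - card S) choose (k - card S)"
    using assms finS by (simp add: n_subsets card_Diff_subset)
  finally show ?thesis
    using True by simp
next
  case False
  have none: "{K. K \<subseteq> U \<and> card K = k \<and> S \<subseteq> K} = {}"
    using False assms card_mono finite_subset by (metis (mono_tags, lifting) Collect_empty_eq)
  show ?thesis
    unfolding none using False by simp
qed

text \<open>Minsky-Papert symmetrization: the fraction of \<open>k\<close>-subsets of
  \<open>U\<close> that contain \<open>S\<close> is \<open>k choose card S\<close> divided by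
  \<open>card U choose card S\<close>, a polynomial in \<open>k\<close> of degree
  \<open>card S\<close>. Multiplying by the number of \<open>k\<close>-subsets turns averages into
  sums.\<close>

lemma symmetrization:
  assumes "finite U" "degree_le U d G"
  obtains p :: "real poly" where "degree p \<le> d"
    and "\<And>k. k \<le> card U \<Longrightarrow> poly p (real k) * real (card U choose k) = (\<Sum>K | K \<subseteq> U \<and> card K = k. G K)"
proof
  define p where "p = (\<Sum>S\<in>Pow U. smult (coef G S / real (card U choose card S)) (choose_poly (card S)))"
  show "degree p \<le> d"
    unfolding p_def
  proof (rule degree_sum_le)
    fix S assume "S \<in> Pow U"
    then have "coef G S = 0 \<or> card S \<le> d"
      using assms(2) by (auto simp: degree_le_def)
    then show "degree (smult (coef G S / real (card U choose card S)) (choose_poly (card S))) \<le> d"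
      using degree_choose_poly[of "card S"] by auto
  qed (use assms in auto)
  fix k assume k: "k \<le> card U"
  have "(\<Sum>K | K \<subseteq> U \<and> card K = k. G K) = (\<Sum>K | K \<subseteq> U \<and> card K = k. \<Sum>S\<in>Pow U. coef G S * of_bool (S \<subseteq> K))"
  proof (intro sum.cong refl)
    fix K assume K: "K \<in> {K. K \<subseteq> U \<and> card K = k}"
    then have "finite K"
      using assms(1) finite_subset by auto
    then have "G K = (\<Sum>S\<in>Pow K. coef G S)"
      by (simp add: moebius_inversion)
    also have "\<dots> = (\<Sum>S\<in>Pow U. coef G S * of_bool (S \<subseteq> K))"
      using K assms(1) by (intro sum.mono_neutral_cong_left) auto
    finally show "G K = (\<Sum>S\<in>Pow U. coef G S * of_bool (S \<subseteq> K))" .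
  qed
  also have "\<dots> = (\<Sum>S\<in>Pow U. coef G S * (\<Sum>K | K \<subseteq> U \<and> card K = k. of_bool (S \<subseteq> K)))"
    by (subst sum.swap) (simp add: sum_distrib_left)
  also have "\<dots> = (\<Sum>S\<in>Pow U. coef G S / real (card U choose card S) * real (k choose card S) * real (card U choose k))"
  proof (intro sum.cong refl)
    fix S assume "S \<in> Pow U"
    then have S: "S \<subseteq> U" "card S \<le> card U"
      using assms(1) by (auto intro: card_mono)
    have fin: "finite {K. K \<subseteq> U \<and> card K = k}"
      using assms(1) by auto
    have "(\<Sum>K | K \<subseteq> U \<and> card K = k. of_bool (S \<subseteq> K) :: real) = real (card ({K. K \<subseteq> U \<and> card K = k} \<inter> {K. S \<subseteq> K}))"
      using fin by (simp add: sum.If_cases of_bool_def)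
    also have "{K. K \<subseteq> U \<and> card K = k} \<inter> {K. S \<subseteq> K} = {K. K \<subseteq> U \<and> card K = k \<and> S \<subseteq> K}"
      by auto
    also have "real (card \<dots>) = real (k choose card S) * real (card U choose k) / real (card U choose card S)"
    proof (cases "card S \<le> k")
      case True
      have "(card U choose k) * (k choose card S) = (card U choose card S) * ((card U - card S) choose (k - card S))"
        by (rule choose_mult[OF True k])
      then have "real (card U choose k) * real (k choose card S) = real (card U choose card S) * real ((card U - card S) choose (k - card S))"
        by (metis of_nat_mult)
      then show ?thesis
        using card_supersets_of_size[OF assms(1) S(1), of k] True S(2) by (simp add: field_simps)
    next
      case False
      then show ?thesis
        using card_supersets_of_size[OF assms(1) S(1), of k] by (simp add: binomial_eq_0)
    qed
    finally show "coef G S * (\<Sum>K | K \<subseteq> U \<and> card K = k. of_bool (S \<subseteq> K))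
        = coef G S / real (card U choose card S) * real (k choose card S) * real (card U choose k)"
      by (simp add: mult_ac)
  qed
  also have "\<dots> = poly p (real k) * real (card U choose k)"
    by (simp add: p_def poly_sum poly_choose_poly sum_distrib_right)
  finally show "poly p (real k) * real (card U choose k) = (\<Sum>K | K \<subseteq> U \<and> card K = k. G K)" ..
qed

text \<open>A monomial of \<open>g\<close> with fewer variables than \<open>K\<close> has blocks
  misses some block of \<open>K\<close>, by disjointness. It does not depend on that block, hence
  contributes 0 to the coefficient at \<open>K\<close>.\<close>

lemma degree_le_blocks:
  assumes "finite V" "degree_le V d g" "sensitive_blocks V g A B b"
  shows "degree_le {..<b} d (\<lambda>K. g (sym_diff A (\<Union>k\<in>K. B k)))"
  unfolding degree_le_def
proof (intro allI impI, rule ccontr)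
  fix K assume K: "K \<subseteq> {..<b}" "coef (\<lambda>K. g (sym_diff A (\<Union>k\<in>K. B k))) K \<noteq> 0" and "\<not> card K \<le> d"
  have finK: "finite K"
    using K(1) finite_subset by blast
  have A: "A \<subseteq> V" and B: "\<And>k. k < b \<Longrightarrow> B k \<subseteq> V" "disjoint_family_on B {..<b}"
    using assms(3) by (auto simp: sensitive_blocks_def)
  have zero: "coef (\<lambda>L. coef g S * of_bool (S \<subseteq> sym_diff A (\<Union>k\<in>L. B k))) K = 0" if S: "S \<subseteq> V" for S
  proof (cases "coef g S = 0")
    case True
    then show ?thesis by (simp add: coef_def)
  next
    case False
    then have small: "card S < card K"
      using assms(2) S \<open>\<not> card K \<le> d\<close> unfolding degree_le_def by (meson le_less_trans not_le)
    have "\<exists>k\<in>K. B k \<inter> S = {}"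
    proof (rule ccontr)
      assume "\<not> (\<exists>k\<in>K. B k \<inter> S = {})"
      then have "\<forall>k\<in>K. \<exists>x. x \<in> B k \<inter> S"
        by blast
      then obtain x where x: "\<And>k. k \<in> K \<Longrightarrow> x k \<in> B k \<inter> S"
        by metis
      have "inj_on x K"
      proof (rule inj_onI)
        fix k l assume kl: "k \<in> K" "l \<in> K" "x k = x l"
        then have "x k \<in> B k \<inter> B l"
          using x[of k] x[of l] by auto
        then show "k = l"
          using kl(1,2) K(1) disjoint_family_onD[OF B(2), of k l] by blast
      qed
      then have "card K \<le> card S"
        using x finite_subset[OF S assms(1)] by (intro card_inj_on_le[of x]) auto
      then show False
        using small by simp
    qed
    then obtain k where "k \<in> K" "B k \<inter> S = {}"
      by blast
    then have "(S \<subseteq> sym_diff A (\<Union>k\<in>insert k L. B k)) = (S \<subseteq> sym_diff A (\<Union>k\<in>L. B k))" for L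
      by blast
    with \<open>k \<in> K\<close> show ?thesis
      by (intro coef_eq_0_if_independent[OF finK, of k]) simp_all
  qed
  have "coef (\<lambda>K. g (sym_diff A (\<Union>k\<in>K. B k))) K
      = coef (\<lambda>L. \<Sum>S\<in>Pow V. coef g S * of_bool (S \<subseteq> sym_diff A (\<Union>k\<in>L. B k))) K"
  proof (rule coef_cong)
    fix L assume "L \<subseteq> K"
    then have sub: "sym_diff A (\<Union>k\<in>L. B k) \<subseteq> V"
      using A B K(1) by blast
    then have "g (sym_diff A (\<Union>k\<in>L. B k)) = (\<Sum>S\<in>Pow (sym_diff A (\<Union>k\<in>L. B k)). coef g S)"
      using moebius_inversion finite_subset[OF sub assms(1)] by metis
    also have "\<dots> = (\<Sum>S\<in>Pow V. coef g S * of_bool (S \<subseteq> sym_diff A (\<Union>k\<in>L. B k)))"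
      using Pow_mono[OF sub] assms(1) by (intro sum.mono_neutral_cong_left) simp_all
    finally show "g (sym_diff A (\<Union>k\<in>L. B k)) = \<dots>" .
  qed
  also have "\<dots> = 0"
    using zero by (simp add: coef_sum)
  finally show False
    using K(2) by simp
qed

text \<open>Models the average value of a Boolean function after flipping \<open>k\<close> of its
  \<open>b\<close> sensitive blocks, normalised to 0 without flips. With \<open>b = 0\<close> there
  is no single block to flip, hence the guard.\<close>

definition step_poly :: "nat \<Rightarrow> real poly \<Rightarrow> bool" where
  "step_poly b p \<longleftrightarrow> poly p 0 = 0 \<and> (0 < b \<longrightarrow> poly p 1 = 1) \<and> (\<forall>k\<le>b. 0 \<le> poly p (real k) \<and> poly p (real k) \<le> 1)"

lemma step_poly_of_blocks:
  assumes "finite V" "boolean_on V g" "degree_le V d g" "sensitive_blocks V g A B b"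
  obtains p where "degree p \<le> d" "step_poly b p"
proof -
  define H where "H = (\<lambda>K. g (sym_diff A (\<Union>k\<in>K. B k)))"
  \<comment> \<open>Complementing if necessary makes the value without flips 0; this changes signs
    and the constant coefficient only, so the degree bound persists.\<close>
  define G where "G = (\<lambda>K. if g A = 0 then H K else 1 - H K)"
  have A: "A \<subseteq> V" and B: "\<And>k. k < b \<Longrightarrow> B k \<subseteq> V" and sens: "\<And>k. k < b \<Longrightarrow> g (sym_diff A (B k)) \<noteq> g A"
    using assms(4) by (auto simp: sensitive_blocks_def)
  have bool: "g S \<in> {0, 1}" if "S \<subseteq> V" for S
    using assms(2) that unfolding boolean_on_def by blast
  have H01: "H K \<in> {0, 1}" if "K \<subseteq> {..<b}" for K
    unfolding H_def using that A B by (intro bool) blast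
  have G01: "0 \<le> G K \<and> G K \<le> 1" if "K \<subseteq> {..<b}" for K
    using H01[OF that] by (auto simp: G_def)
  have G0: "G {} = 0"
    using bool[OF A] by (auto simp: G_def H_def)
  have G1: "G {k} = 1" if "k < b" for k
  proof -
    have "H {k} \<in> {0, 1}" "H {k} \<noteq> g A"
      using H01[of "{k}"] sens[OF that] that by (auto simp: H_def)
    then show ?thesis
      using bool[OF A] by (auto simp: G_def)
  qed
  have "degree_le {..<b} d G"
    unfolding degree_le_def
  proof (intro allI impI)
    fix K assume K: "K \<subseteq> {..<b}" "coef G K \<noteq> 0"
    have "coef G K = coef H K \<or> coef G K = coef (\<lambda>_. 1) K - coef H K"
      by (cases "g A = 0") (simp_all add: G_def coef_diff)
    then have "K = {} \<or> coef H K \<noteq> 0"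
      using K coef_const[of K 1] finite_subset[OF K(1)] by (auto split: if_splits)
    then show "card K \<le> d"
      using degree_le_blocks[OF assms(1,3,4)] K(1) by (auto simp: degree_le_def H_def)
  qed
  then obtain p :: "real poly" where p: "degree p \<le> d"
    and avg: "\<And>k. k \<le> b \<Longrightarrow> poly p (real k) * real (b choose k) = (\<Sum>K | K \<subseteq> {..<b} \<and> card K = k. G K)"
    using symmetrization[of "{..<b}" d G] by auto
  have "step_poly b p"
    unfolding step_poly_def
  proof (intro conjI impI allI)
    have "{K. K \<subseteq> {..<b} \<and> card K = 0} = {{}}"
      by (auto simp: finite_subset)
    then show "poly p 0 = 0"
      using avg[of 0] G0 by simp
  next
    assume "0 < b"
    have "(\<Sum>K | K \<subseteq> {..<b} \<and> card K = 1. G K) = (\<Sum>K | K \<subseteq> {..<b} \<and> card K = 1. 1)"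
      using G1 by (intro sum.cong refl) (auto simp: card_1_singleton_iff)
    also have "\<dots> = real b"
      using n_subsets[of "{..<b}" 1] by simp
    finally show "poly p 1 = 1"
      using avg[of 1] \<open>0 < b\<close> by simp
  next
    fix k assume k: "k \<le> b"
    have "0 \<le> (\<Sum>K | K \<subseteq> {..<b} \<and> card K = k. G K)"
      using G01 by (intro sum_nonneg) auto
    moreover have "(\<Sum>K | K \<subseteq> {..<b} \<and> card K = k. G K) \<le> (\<Sum>K | K \<subseteq> {..<b} \<and> card K = k. 1)"
      using G01 by (intro sum_mono) auto
    then have "(\<Sum>K | K \<subseteq> {..<b} \<and> card K = k. G K) \<le> real (b choose k)"
      using n_subsets[of "{..<b}" k] by simp
    moreover have "real (b choose k) > 0"
      using k by simp
    ultimately show "0 \<le> poly p (real k)" "poly p (real k) \<le> 1"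
      using avg[OF k] by (metis zero_le_mult_iff less_le_not_le, metis mult_le_cancel_right1 less_le_not_le mult_le_cancel_right2)
  qed
  then show ?thesis
    using that p by blast
qed

section \<open>Divided differences over chosen nodes\<close>

lemma divided_difference_eq_0:
  fixes p :: "'a :: field poly"
  assumes "finite X" "degree p + 1 < card X"
  shows "(\<Sum>x\<in>X. poly p x / (\<Prod>y\<in>X - {x}. x - y)) = 0"
proof -
  define r where "r x = poly p x / (\<Prod>y\<in>X - {x}. x - y)" for x
  define N where "N x = (\<Prod>y\<in>X - {x}. [:-y, 1:])" for x
  \<comment> \<open>The Lagrange interpolant of \<open>p\<close> on \<open>X\<close>. It equals
    \<open>p\<close>, whose degree is below \<open>card X - 1\<close>; its coefficient at that
    exponent is the divided difference, as every \<open>N x\<close> is monic.\<close>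
  define q where "q = (\<Sum>x\<in>X. smult (r x) (N x))"
  have monic: "lead_coeff (N x) = 1" for x
    by (simp add: N_def lead_coeff_prod)
  have deg: "degree (N x) = card X - 1" if "x \<in> X" for x
    using that assms(1) by (simp add: N_def degree_prod_eq_sum_degree)
  have "degree q \<le> card X - 1"
    unfolding q_def using assms(1) deg by (intro degree_sum_le) (auto intro: order_trans[OF degree_smult_le])
  moreover have "poly q x = poly p x" if "x \<in> X" for x
  proof -
    have "poly q x = (\<Sum>z\<in>X. r z * (\<Prod>y\<in>X - {z}. x - y))"
      by (simp add: q_def poly_sum N_def poly_prod)
    also have "\<dots> = (\<Sum>z\<in>{x}. r z * (\<Prod>y\<in>X - {z}. x - y))"
      using that assms(1) by (intro sum.mono_neutral_right) (auto intro!: prod_zero)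
    also have "\<dots> = poly p x"
      using assms(1) by (auto simp: r_def)
    finally show ?thesis .
  qed
  ultimately have "q = p"
    using assms by (intro poly_eqI_degree[of X]) auto
  then have "0 = coeff q (card X - 1)"
    using assms(2) by (simp add: coeff_eq_0)
  also have "\<dots> = (\<Sum>x\<in>X. r x * coeff (N x) (card X - 1))"
    by (simp add: q_def coeff_sum)
  also have "\<dots> = (\<Sum>x\<in>X. r x)"
    using monic deg by (intro sum.cong refl) (metis mult.right_neutral)
  finally show ?thesis
    by (simp add: r_def)
qed

text \<open>In the vanishing divided difference times \<open>N 1\<close>, node 0 contributes 0 and
  node 1 contributes 1, so the other terms sum to -1. As the values lie in [0,1], only negative
  ratios can help, each by at most its absolute value.\<close>

lemma step_poly_nodes:
  fixes X :: "real set" and p :: "real poly"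
  assumes "finite X" "degree p + 1 < card X" "0 \<in> X" "1 \<in> X" "poly p 0 = 0" "poly p 1 = 1"
    and "\<And>x. x \<in> X \<Longrightarrow> 0 \<le> poly p x \<and> poly p x \<le> 1"
  defines "N \<equiv> \<lambda>x. \<Prod>y\<in>X - {x}. x - y"
  shows "1 \<le> (\<Sum>x\<in>X - {0, 1}. max 0 (- (N 1 / N x)))"
proof -
  have "N 1 \<noteq> 0"
    using assms(1) by (simp add: N_def)
  have "0 = N 1 * (\<Sum>x\<in>X. poly p x / N x)"
    using divided_difference_eq_0[OF assms(1,2)] by (simp add: N_def)
  also have "\<dots> = (\<Sum>x\<in>X. poly p x * (N 1 / N x))"
    by (simp add: sum_distrib_left mult_ac)
  also have "\<dots> = (\<Sum>x\<in>X - {0, 1}. poly p x * (N 1 / N x)) + (\<Sum>x\<in>{0, 1}. poly p x * (N 1 / N x))"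
    using assms(1,3,4) by (intro sum.subset_diff) auto
  also have "(\<Sum>x\<in>{0, 1}. poly p x * (N 1 / N x)) = 1"
    using assms(5,6) \<open>N 1 \<noteq> 0\<close> by simp
  finally have "1 = (\<Sum>x\<in>X - {0, 1}. poly p x * - (N 1 / N x))"
    by (simp add: sum_negf)
  also have "\<dots> \<le> (\<Sum>x\<in>X - {0, 1}. max 0 (- (N 1 / N x)))"
  proof (rule sum_mono)
    fix x assume "x \<in> X - {0, 1}"
    then have "0 \<le> poly p x" "poly p x \<le> 1"
      using assms(7) by auto
    then show "poly p x * - (N 1 / N x) \<le> max 0 (- (N 1 / N x))"
      by (cases "- (N 1 / N x) \<ge> 0")
        (simp_all add: mult_left_le_one_le mult_nonneg_nonpos max_def del: mult_minus_right)
  qed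
  finally show ?thesis .
qed

subsection \<open>Upper bounds for block sensitivity\<close>

definition step_bound :: "nat \<Rightarrow> nat \<Rightarrow> bool" where
  "step_bound d B \<longleftrightarrow> (\<forall>p b. degree p \<le> d \<longrightarrow> step_poly b p \<longrightarrow> b \<le> B)"

definition node_prod :: "int list \<Rightarrow> int \<Rightarrow> int" where
  "node_prod xs x = prod_list (map (\<lambda>y. if y = x then 1 else x - y) xs)"

text \<open>Integer form of the hypothesis refuted by \<open>step_poly_nodes\<close>: each ratio is rounded up to a
  multiple of $10^{-6}$.\<close>
definition node_check :: "int list \<Rightarrow> bool" where
  "node_check xs \<longleftrightarrow> distinct xs \<and> 0 \<in> set xs \<and> 1 \<in> set xs \<and>
     sum_list (map (\<lambda>x. if x = 0 \<or> x = 1 \<or> 0 \<le> node_prod xs 1 * node_prod xs x then 0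
       else 1000000 * \<bar>node_prod xs 1\<bar> div \<bar>node_prod xs x\<bar> + 1) xs) < 1000000"

text \<open>If \<open>b\<close> exceeded \<open>B\<close>, all nodes, being at most
  \<open>B + 1\<close>, would be points where the step polynomial lies in [0,1]. Since
  \<open>d + 2\<close> nodes annihilate degree \<open>d\<close>, \<open>step_poly_nodes\<close>
  would contradict the check.\<close>

lemma step_bound_nodes:
  assumes "node_check xs" "length xs = d + 2" "\<forall>x\<in>set xs. 0 \<le> x \<and> x \<le> int B + 1"
  shows "step_bound d B"
  unfolding step_bound_def
proof (intro allI impI, rule ccontr)
  fix p :: "real poly" and b assume p: "degree p \<le> d" "step_poly b p" and "\<not> b \<le> B"
  define X where "X = real_of_int ` set xs"
  define N where "N = (\<lambda>x. \<Prod>y\<in>X - {x}. x - y)"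
  define P where "P = node_prod xs"
  define u where "u x = (if x = 0 \<or> x = 1 \<or> 0 \<le> P 1 * P x then 0 else 1000000 * \<bar>P 1\<bar> div \<bar>P x\<bar> + 1)" for x
  have xs: "distinct xs" "0 \<in> set xs" "1 \<in> set xs" "(\<Sum>x\<in>set xs. u x) < 1000000"
    using assms(1) unfolding u_def P_def by (auto simp: node_check_def sum_list_distinct_conv_sum_set)
  have P: "P x = (\<Prod>y\<in>set xs - {x}. x - y)" for x
  proof -
    have "P x = (\<Prod>y\<in>set xs. if y = x then 1 else x - y)"
      using xs(1) by (simp add: P_def node_prod_def prod.distinct_set_conv_list)
    also have "\<dots> = (\<Prod>y\<in>set xs - {x}. x - y)"
      by (rule prod.mono_neutral_cong_right) auto
    finally show ?thesis .
  qed
  have N: "N (of_int x) = of_int (P x)" for x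
  proof -
    have "X - {of_int x} = real_of_int ` (set xs - {x})"
      by (auto simp: X_def)
    then have "N (of_int x) = (\<Prod>y\<in>set xs - {x}. of_int x - of_int y)"
      unfolding N_def by (simp add: prod.reindex inj_on_def)
    then show ?thesis
      by (simp add: P)
  qed
  have P_nz: "P x \<noteq> 0" for x
    by (simp add: P)
  have bound: "max 0 (- (N 1 / N (of_int x))) \<le> u x / 1000000" if "x \<noteq> 0" "x \<noteq> 1" for x
  proof (cases "0 \<le> P 1 * P x")
    case True
    then have "0 \<le> N 1 / N (of_int x)"
      using N[of 1] N[of x] by (simp add: zero_le_divide_iff zero_le_mult_iff)
    then show ?thesis
      using True by (simp add: u_def)
  next
    case False
    \<comment> \<open>The quotient rounded down plus one exceeds the scaled ratio, so the integer
      check bounds the real sum from above.\<close>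
    define n m where "n = 1000000 * \<bar>P 1\<bar>" and "m = \<bar>P x\<bar>"
    have "m > 0"
      using P_nz[of x] by (simp add: m_def)
    then have "n mod m < m" "n = n div m * m + n mod m"
      by simp_all
    moreover have "u x = n div m + 1"
      using False that by (simp add: u_def n_def m_def)
    then have "u x * m = n div m * m + m"
      by (simp only: distrib_right mult_1)
    ultimately have "n \<le> u x * m"
      by linarith
    then have "real_of_int n \<le> real_of_int (u x) * real_of_int m"
      by (simp only: of_int_le_iff flip: of_int_mult)
    then have "1000000 * \<bar>real_of_int (P 1)\<bar> \<le> real_of_int (u x) * \<bar>real_of_int (P x)\<bar>"
      by (simp add: n_def m_def)
    then have "\<bar>real_of_int (P 1)\<bar> / \<bar>real_of_int (P x)\<bar> \<le> u x / 1000000"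
      using P_nz[of x] by (simp add: field_simps)
    moreover have "- (N 1 / N (of_int x)) \<le> \<bar>real_of_int (P 1)\<bar> / \<bar>real_of_int (P x)\<bar>"
      using N[of 1] N[of x] abs_ge_minus_self[of "N 1 / N (of_int x)"] by (simp add: abs_divide)
    moreover have "0 \<le> \<bar>real_of_int (P 1)\<bar> / \<bar>real_of_int (P x)\<bar>"
      by simp
    ultimately show ?thesis
      by linarith
  qed
  have card: "card X = d + 2"
    using xs(1) assms(2) by (simp add: X_def card_image inj_on_def distinct_card)
  have nodes: "0 \<le> poly p x \<and> poly p x \<le> 1" if x: "x \<in> X" for x
  proof -
    obtain z where z: "z \<in> set xs" "x = of_int z"
      using x by (auto simp: X_def)
    then have "x = real (nat z)" "nat z \<le> b"
      using assms(3) \<open>\<not> b \<le> B\<close> by auto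
    then show ?thesis
      using p(2) by (auto simp: step_poly_def)
  qed
  have "1 \<le> (\<Sum>x\<in>X - {0, 1}. max 0 (- (N 1 / N x)))"
    unfolding N_def using p \<open>\<not> b \<le> B\<close> xs(2,3) card nodes
    by (intro step_poly_nodes) (auto simp: X_def step_poly_def)
  also have "X - {0, 1} = real_of_int ` (set xs - {0, 1})"
    by (auto simp: X_def)
  also have "(\<Sum>x\<in>\<dots>. max 0 (- (N 1 / N x))) = (\<Sum>x\<in>set xs - {0, 1}. max 0 (- (N 1 / N (of_int x))))"
    by (simp add: sum.reindex inj_on_def)
  also have "\<dots> \<le> (\<Sum>x\<in>set xs - {0, 1}. u x / 1000000)"
    using bound by (intro sum_mono) auto
  also have "\<dots> = real_of_int (\<Sum>x\<in>set xs - {0, 1}. u x) / 1000000"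
    by (simp add: sum_divide_distrib)
  also have "(\<Sum>x\<in>set xs - {0, 1}. u x) = (\<Sum>x\<in>set xs. u x)"
    by (rule sum.mono_neutral_left) (auto simp: u_def)
  finally show False
    using xs(4) by (simp del: of_int_sum)
qed

text \<open>The node lists were found by a numerical local search started from Chebyshev nodes.\<close>
lemma step_bound_8: "step_bound 8 38"
  by (rule step_bound_nodes[of "[0, 1, 2, 6, 12, 19, 27, 33, 37, 39]"])
    (simp_all add: node_check_def node_prod_def)

lemma step_bound_9: "step_bound 9 47"
  by (rule step_bound_nodes[of "[0, 1, 2, 6, 12, 20, 28, 36, 42, 46, 48]"])
    (simp_all add: node_check_def node_prod_def)

lemma step_bound_10: "step_bound 10 58"
  by (rule step_bound_nodes[of "[0, 1, 2, 6, 12, 20, 29, 39, 47, 53, 57, 59]"])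
    (simp_all add: node_check_def node_prod_def)

lemma step_bound_11: "step_bound 11 71"
  by (rule step_bound_nodes[of "[0, 1, 2, 6, 12, 21, 31, 41, 51, 60, 66, 70, 72]"])
    (simp_all add: node_check_def node_prod_def)

lemma step_bound_12: "step_bound 12 84"
  by (rule step_bound_nodes[of "[0, 1, 2, 6, 13, 21, 32, 42, 53, 64, 72, 79, 83, 85]"])
    (simp_all add: node_check_def node_prod_def)

lemma step_bound_13: "step_bound 13 99"
  by (rule step_bound_nodes[of "[0, 1, 2, 6, 13, 22, 32, 44, 56, 68, 78, 87, 94, 98, 100]"])
    (simp_all add: node_check_def node_prod_def)

lemma step_bound_14: "step_bound 14 114"
  by (rule step_bound_nodes[of "[0, 1, 2, 6, 13, 22, 33, 45, 57, 70, 82, 93, 102, 109, 113, 115]"])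
    (simp_all add: node_check_def node_prod_def)

lemma step_bound_15: "step_bound 15 131"
  by (rule step_bound_nodes[of "[0, 1, 2, 6, 13, 22, 33, 46, 59, 73, 86, 99, 110, 119, 126, 130, 132]"])
    (simp_all add: node_check_def node_prod_def)

lemma step_bound_16: "step_bound 16 149"
  by (rule step_bound_nodes[of "[0, 1, 2, 6, 13, 22, 33, 46, 60, 75, 90, 104, 117, 128, 137, 144, 148, 150]"])
    (simp_all add: node_check_def node_prod_def)

lemma step_bound_17: "step_bound 17 168"
  by (rule step_bound_nodes[of "[0, 1, 2, 6, 13, 22, 34, 47, 61, 77, 92, 108, 122, 135, 147, 156, 163, 167, 169]"])
    (simp_all add: node_check_def node_prod_def)

lemma step_bound_18: "step_bound 18 189"
  by (rule step_bound_nodes[of "[0, 1, 2, 6, 13, 22, 34, 48, 63, 79, 95, 111, 127, 142, 156, 168, 177, 184, 188, 190]"])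
    (simp_all add: node_check_def node_prod_def)

lemma step_bound_19: "step_bound 19 210"
  by (rule step_bound_nodes[of "[0, 1, 2, 6, 13, 22, 34, 48, 63, 80, 97, 114, 131, 148, 163, 177, 189, 198, 205, 209, 211]"])
    (simp_all add: node_check_def node_prod_def)

lemma step_bound_20: "step_bound 20 233"
  by (rule step_bound_nodes[of "[0, 1, 2, 6, 13, 22, 34, 48, 64, 81, 99, 117, 135, 153, 170, 186, 200, 212, 221, 228, 232, 234]"])
    (simp_all add: node_check_def node_prod_def)

section \<open>A quadratic bound in every degree\<close>

lemma alternating_binomial_sum_eq_0:
  fixes q :: "real poly"
  assumes "degree q < n"
  shows "(\<Sum>k\<le>n. (-1) ^ k * real (n choose k) * poly q (real k)) = 0"
  using assms
proof (induction n arbitrary: q)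
  case (Suc n)
  define f where "f k = poly q (real k)" for k
  \<comment> \<open>Leading coefficients cancel in the difference of \<open>q\<close> and its shift,
    so the degree drops; Pascal's rule reduces the sum of order \<open>Suc n\<close> for
    \<open>q\<close> to that of order \<open>n\<close> for \<open>r\<close>.\<close>
  define r where "r = q - pcompose q [:1, 1:]"
  have "coeff (pcompose q [:1, 1:]) (degree q) = lead_coeff q"
    using lead_coeff_comp[of "[:1, 1:]" q] by (simp add: degree_pcompose)
  then have "coeff r (degree q) = 0"
    by (simp add: r_def)
  moreover have "degree r \<le> degree q"
    unfolding r_def by (intro degree_diff_le) (auto simp: degree_pcompose)
  ultimately have "r = 0 \<or> degree r < degree q"
    using eq_zero_or_degree_less by blast
  then have IH: "(\<Sum>k\<le>n. (-1) ^ k * real (n choose k) * poly r (real k)) = 0"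
    using Suc.IH[of r] Suc.prems by auto
  have shift: "(\<Sum>k\<le>n. (-1) ^ k * real (n choose Suc k) * f (Suc k)) = f 0 - (\<Sum>k\<le>n. (-1) ^ k * real (n choose k) * f k)"
  proof -
    have "(\<Sum>k\<le>n. (-1) ^ k * real (n choose k) * f k) = (\<Sum>k\<le>Suc n. (-1) ^ k * real (n choose k) * f k)"
      by simp
    also have "\<dots> = f 0 - (\<Sum>k\<le>n. (-1) ^ k * real (n choose Suc k) * f (Suc k))"
      by (subst sum.atMost_Suc_shift) (simp add: sum_negf)
    finally show ?thesis by simp
  qed
  have "(\<Sum>k\<le>Suc n. (-1) ^ k * real (Suc n choose k) * f k)
      = f 0 - (\<Sum>k\<le>n. (-1) ^ k * real (n choose k) * f (Suc k)) - (\<Sum>k\<le>n. (-1) ^ k * real (n choose Suc k) * f (Suc k))"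
    by (subst sum.atMost_Suc_shift) (simp add: sum.distrib sum_negf sum_subtractf algebra_simps)
  also have "\<dots> = (\<Sum>k\<le>n. (-1) ^ k * real (n choose k) * (f k - f (Suc k)))"
    unfolding shift by (simp add: right_diff_distrib sum_subtractf)
  also have "\<dots> = 0"
    using IH by (simp add: r_def f_def poly_pcompose algebra_simps)
  finally show ?case
    by (simp add: f_def)
qed simp

lemma sum_symmetric_split:
  fixes F :: "nat \<Rightarrow> real"
  shows "(\<Sum>k\<le>2 * d. F k) = F d + (\<Sum>i=1..d. F (d - i) + F (d + i))"
proof -
  have "{..2 * d} = insert d ((\<lambda>i. d - i) ` {1..d} \<union> (\<lambda>i. d + i) ` {1..d})"
  proof (intro equalityI subsetI)
    fix k assume "k \<in> {..2 * d}"
    then consider "k = d" | "k < d" | "d < k" "k \<le> 2 * d"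
      by force
    then show "k \<in> insert d ((\<lambda>i. d - i) ` {1..d} \<union> (\<lambda>i. d + i) ` {1..d})"
    proof cases
      case 2
      then show ?thesis
        by (intro insertI2 UnI1 image_eqI[of _ _ "d - k"]) auto
    next
      case 3
      then show ?thesis
        by (intro insertI2 UnI2 image_eqI[of _ _ "k - d"]) auto
    qed simp
  qed auto
  also have "sum F \<dots> = F d + (sum F ((\<lambda>i. d - i) ` {1..d}) + sum F ((\<lambda>i. d + i) ` {1..d}))"
    by (subst sum.insert) (auto intro!: sum.union_disjoint)
  also have "sum F ((\<lambda>i. d - i) ` {1..d}) = (\<Sum>i=1..d. F (d - i))"
    by (subst sum.reindex) (auto simp: inj_on_def)
  also have "sum F ((\<lambda>i. d + i) ` {1..d}) = (\<Sum>i=1..d. F (d + i))"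
    by (subst sum.reindex) auto
  finally show ?thesis
    by (simp add: sum.distrib)
qed

text \<open>Telescoping of 1/(i^2 - 1) = (1/(i - 1) - 1/(i + 1))/2 from \<open>i = 2\<close> on; the
  term with vanishing denominator is replaced by 0.\<close>

lemma sum_inverse_squares_minus_1_le:
  "(\<Sum>i=1..Suc d. if i = 1 then 0 else 1 / ((real i)\<^sup>2 - 1)) \<le> 3/4 - (1 / (real d + 1) + 1 / (real d + 2)) / 2"
proof (induction d)
  case (Suc d)
  have factor: "(real d + 2)\<^sup>2 - 1 = (real d + 1) * (real d + 3)"
    by (simp add: power2_eq_square algebra_simps)
  have "1 / ((real d + 1) * (real d + 3)) = (1 / (real d + 1) - 1 / (real d + 3)) / 2"
    by (simp add: divide_simps)
  then have "1 / ((real d + 2)\<^sup>2 - 1) = (1 / (real d + 1) - 1 / (real d + 3)) / 2"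
    by (simp only: factor)
  moreover define a where "a i = (if i = 1 then 0 else 1 / ((real i)\<^sup>2 - 1))" for i :: nat
  moreover have "real (Suc (Suc d)) = real d + 2"
    by simp
  ultimately have "a (Suc (Suc d)) = (1 / (real d + 1) - 1 / (real d + 3)) / 2"
    by (simp only: a_def) simp
  moreover have "(\<Sum>i=1..Suc (Suc d). a i) = (\<Sum>i=1..Suc d. a i) + a (Suc (Suc d))"
    by (simp only: sum.cl_ivl_Suc) simp
  moreover have "real (Suc d) + 1 = real d + 2" "real (Suc d) + 2 = real d + 3"
    by simp_all
  ultimately show ?case
    using Suc.IH unfolding a_def[symmetric] by (simp only:) argo
qed simp

text \<open>Apply the vanishing alternating sum of order $2d$ to $q(x) = (p(2x) - p(1))/(2x - 1)$ at the
  squares $x = (k-d)^2$: the terms $k = d \pm 1$ have the same sign as the central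
  one, and all others together are smaller than it.\<close>
lemma step_bound_quadratic:
  assumes "d \<ge> 1"
  shows "step_bound d (2 * d\<^sup>2 - 1)"
  unfolding step_bound_def
proof (intro allI impI, rule ccontr)
  fix p :: "real poly" and b assume p: "degree p \<le> d" "step_poly b p" and "\<not> b \<le> 2 * d\<^sup>2 - 1"
  moreover have "d\<^sup>2 \<ge> 1"
    using assms by simp
  ultimately have b: "2 * d\<^sup>2 \<le> b" "0 < b"
    by linarith+
  have p0: "poly p 0 = 0" and p1: "poly p 1 = 1" and p01: "\<And>k. k \<le> b \<Longrightarrow> 0 \<le> poly p (real k) \<and> poly p (real k) \<le> 1"
    using p(2) b(2) by (auto simp: step_poly_def)
  \<comment> \<open>The root makes the quotient a polynomial: \<open>s\<close> is twice the $q$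
    above and has degree at most \<open>d - 1\<close>, so composing it with a square stays below
    degree \<open>2 * d\<close>.\<close>
  have "poly (pcompose p [:0, 2:] - 1) (1/2) = 0"
    using p1 by (simp add: poly_pcompose)
  then obtain s where s: "pcompose p [:0, 2:] - 1 = [:-(1/2), 1:] * s"
    using poly_eq_0_iff_dvd by (metis dvdE)
  have "degree s \<le> d - 1"
  proof (cases "s = 0")
    case False
    have "degree (pcompose p [:0, 2:] - 1) \<le> d"
      using p(1) by (intro degree_diff_le) (simp_all add: degree_pcompose)
    then have "degree ([:-(1/2), 1:] * s) \<le> d"
      by (simp only: s)
    then show ?thesis
      using False by (subst (asm) degree_mult_eq) auto
  qed simp
  then have deg: "degree (pcompose s ([:- real d, 1:]\<^sup>2)) < 2 * d"
    using assms by (simp add: degree_pcompose degree_power_eq)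
  define C where "C = real (2 * d choose d)"
  define h where "h k = poly s ((real k - real d)\<^sup>2)" for k
  define F where "F k = (-1) ^ (k + d) * real (2 * d choose k) * h k" for k
  have "(\<Sum>k\<le>2 * d. F k) = (-1) ^ d * (\<Sum>k\<le>2 * d. (-1) ^ k * real (2 * d choose k) * h k)"
    by (simp add: F_def sum_distrib_left power_add mult_ac)
  then have total: "(\<Sum>k\<le>2 * d. F k) = 0"
    using alternating_binomial_sum_eq_0[OF deg] by (simp add: h_def poly_pcompose algebra_simps)
  have s_val: "poly s x = 2 * (poly p (2 * x) - 1) / (2 * x - 1)" if "2 * x \<noteq> 1" for x
  proof -
    have "poly p (2 * x) - 1 = (x - 1/2) * poly s x"
      using arg_cong[OF s, of "\<lambda>q. poly q x"] by (simp add: poly_pcompose algebra_simps)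
    then show ?thesis
      using that by (simp add: field_simps)
  qed
  have Fd: "F d = 2 * C"
    using s_val[of 0] p0 by (simp add: F_def h_def C_def flip: mult_2)
  have F_ge: "F k \<ge> - C * (if i = 1 then 0 else 1 / ((real i)\<^sup>2 - 1))"
    if i: "1 \<le> i" "i \<le> d" and k: "k = d - i \<or> k = d + i" for i k
  proof -
    have sq: "(real k - real d)\<^sup>2 = (real i)\<^sup>2"
      using i k by (auto simp: of_nat_diff)
    have i2: "1 \<le> (real i)\<^sup>2"
      using i by simp
    then have "2 * (real i)\<^sup>2 \<noteq> 1"
      by linarith
    then have hk: "h k = 2 * (poly p (2 * (real i)\<^sup>2) - 1) / (2 * (real i)\<^sup>2 - 1)"
      unfolding h_def sq by (rule s_val)
    \<comment> \<open>The assumed size of \<open>b\<close> enters here: all arguments of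
      \<open>p\<close> are integers up to twice the square of \<open>d\<close>, where its values lie
      in [0,1].\<close>
    have "2 * i\<^sup>2 \<le> 2 * d\<^sup>2"
      using i by (simp add: power_mono)
    then have "2 * i\<^sup>2 \<le> b"
      using b(1) by (rule order_trans)
    then have pi: "0 \<le> poly p (2 * (real i)\<^sup>2)" "poly p (2 * (real i)\<^sup>2) \<le> 1"
      using p01[of "2 * i\<^sup>2"] by simp_all
    have C_ge: "real (2 * d choose k) \<le> C"
      unfolding C_def by (simp add: binomial_maximum')
    show ?thesis
    proof (cases "i = 1")
      case True
      then have "odd (k + d)"
        using k i by auto
      moreover have "h k \<le> 0"
        using pi hk True by simp
      ultimately show ?thesis
        using True by (simp add: F_def mult_nonneg_nonpos)
    next
      case False
      then have "2 \<le> i"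
        using i by simp
      then have i4: "4 \<le> (real i)\<^sup>2"
        using power_mono[of 2 "real i" 2] by simp
      define y where "y = (real i)\<^sup>2 - 1"
      have y: "y \<ge> 3" "2 * (real i)\<^sup>2 - 1 = 2 * y + 1"
        using i4 by (simp_all add: y_def)
      have "\<bar>h k\<bar> \<le> 2 / (2 * (real i)\<^sup>2 - 1)"
        using pi i2 by (simp add: hk abs_divide divide_right_mono)
      \<comment> \<open>Weakened to a form that telescopes in the sum over \<open>i\<close>.\<close>
      also have "\<dots> \<le> 1 / y"
        using y(1) unfolding y(2) by (simp add: field_simps)
      finally have "\<bar>F k\<bar> \<le> C * (1 / y)"
        unfolding F_def abs_mult using C_ge by (intro mult_mono) (auto simp: power_abs)
      then show ?thesis
        using False unfolding y_def[symmetric] by simp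
    qed
  qed
  define L where "L = (\<Sum>i=1..d. if i = 1 then 0 else 1 / ((real i)\<^sup>2 - 1))"
  have "(\<Sum>i=1..d. - (2 * C) * (if i = 1 then 0 else 1 / ((real i)\<^sup>2 - 1))) \<le> (\<Sum>i=1..d. F (d - i) + F (d + i))"
  proof (rule sum_mono)
    fix i assume "i \<in> {1..d}"
    then have "1 \<le> i" "i \<le> d" by auto
    define l where "l = (if i = 1 then 0 else 1 / ((real i)\<^sup>2 - 1))"
    have "F (d - i) \<ge> - C * l" "F (d + i) \<ge> - C * l"
      unfolding l_def by (intro F_ge; use \<open>1 \<le> i\<close> \<open>i \<le> d\<close> in simp)+
    then show "- (2 * C) * (if i = 1 then 0 else 1 / ((real i)\<^sup>2 - 1)) \<le> F (d - i) + F (d + i)"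
      unfolding l_def[symmetric] by linarith
  qed
  then have "- (2 * C) * L \<le> (\<Sum>i=1..d. F (d - i) + F (d + i))"
    by (simp add: L_def sum_distrib_left)
  then have "2 * C - 2 * C * L \<le> 0"
    using total Fd unfolding sum_symmetric_split by simp
  moreover have "L \<le> 3/4"
  proof -
    obtain d' where d': "d = Suc d'"
      using assms by (cases d) auto
    define e where "e = 1 / (real d' + 1) + 1 / (real d' + 2)"
    have "0 \<le> e"
      by (simp add: e_def)
    moreover have "L \<le> 3/4 - e / 2"
      unfolding L_def d' e_def by (rule sum_inverse_squares_minus_1_le)
    ultimately show ?thesis
      by linarith
  qed
  moreover have "C > 0"
    by (simp add: C_def)
  ultimately have "C * 1 \<le> C * L" "C * L \<le> C * (3/4)"
    by (auto intro: mult_left_mono)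
  then show False
    using \<open>C > 0\<close> by simp
qed

subsection \<open>The recursion on the degree\<close>

text \<open>A bound affine in \<open>b\<close>: the slope \<open>r\<close> is the price of one step
  that lowers the block sensitivity, so the bound is stable under such steps.\<close>

definition weight_line :: "'a set \<Rightarrow> nat \<Rightarrow> real \<Rightarrow> real \<Rightarrow> bool" where
  "weight_line V d c r \<longleftrightarrow> (\<forall>g b. boolean_on V g \<longrightarrow> degree_le V d g \<longrightarrow> block_sensitivity_le V b g
     \<longrightarrow> total_weight V g \<le> c + r * real b)"

definition weight_max :: "'a set \<Rightarrow> nat \<Rightarrow> real \<Rightarrow> bool" where
  "weight_max V d m \<longleftrightarrow> (\<forall>g. boolean_on V g \<longrightarrow> degree_le V d g \<longrightarrow> total_weight V g \<le> m)"

lemma block_sensitivity_le_of_step_bound: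
  assumes "finite V" "boolean_on V g" "degree_le V d g" "step_bound d B"
  shows "block_sensitivity_le V B g"
  unfolding block_sensitivity_le_def
proof (intro allI impI)
  fix A Bl k assume "sensitive_blocks V g A Bl k"
  from step_poly_of_blocks[OF assms(1-3) this] obtain p where "degree p \<le> d" "step_poly k p" .
  then show "k \<le> B"
    using assms(4) by (simp add: step_bound_def)
qed

lemma weight_max_of_line:
  assumes "finite V" "weight_line V d c r" "step_bound d B"
  shows "weight_max V d (c + r * real B)"
  unfolding weight_max_def
proof (intro allI impI)
  fix g assume g: "boolean_on V g" "degree_le V d g"
  from block_sensitivity_le_of_step_bound[OF assms(1) this assms(3)]
  show "total_weight V g \<le> c + r * real B"
    using assms(2) g by (simp add: weight_line_def)
qed

lemma weight_max_half: "finite V \<Longrightarrow> weight_max V d (real d / 2)"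
  unfolding weight_max_def by (intro allI impI total_weight_le_half_degree)

lemma weight_line_of_max:
  assumes "weight_max V d m" "0 \<le> r"
  shows "weight_line V d m r"
  unfolding weight_line_def
proof (intro allI impI)
  fix g b assume "boolean_on V g" "degree_le V d g"
  then have "total_weight V g \<le> m"
    using assms(1) by (simp add: weight_max_def)
  then show "total_weight V g \<le> m + r * real b"
    using assms(2) by (simp add: add_increasing2)
qed

lemma boolean_on_restrict_to:
  "M \<subseteq> V \<Longrightarrow> \<alpha> \<subseteq> M \<Longrightarrow> boolean_on V g \<Longrightarrow> boolean_on V (restrict_to M \<alpha> g)"
  unfolding boolean_on_def restrict_to_def by (simp add: le_supI subset_trans[OF Diff_subset] subset_trans[of \<alpha> M V])

text \<open>Induction on \<open>b\<close>: fixing a monomial of degree \<open>Suc d\<close> costs at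
  most \<open>r\<close>, and every restriction has block sensitivity at most \<open>b - 1\<close>.
  Functions of degree at most \<open>d\<close> are covered by the old line.\<close>

lemma weight_line_Suc:
  assumes "finite V" "weight_line V d c r" "real (Suc d) / 2 ^ Suc d \<le> r"
  shows "weight_line V (Suc d) c r"
proof -
  have "total_weight V g \<le> c + r * real b"
    if "boolean_on V g" "degree_le V (Suc d) g" "block_sensitivity_le V b g" for g b
    using that
  proof (induction b arbitrary: g rule: less_induct)
    case (less b)
    show ?case
    proof (cases "degree_le V d g")
      case True
      then show ?thesis
        using assms(2) less.prems by (simp add: weight_line_def)
    next
      case False
      then obtain M where M: "M \<subseteq> V" "coef g M \<noteq> 0" "\<not> card M \<le> d"
        by (auto simp: degree_le_def)
      moreover have "card M \<le> Suc d"
        using M(1,2) less.prems(2) by (simp add: degree_le_def)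
      ultimately have card: "card M = Suc d"
        by simp
      then have ne: "M \<noteq> {}"
        by auto
      have deg: "degree_le V (card M) g"
        using less.prems(2) card by simp
      note bs = block_sensitivity_restrict_to[OF assms(1) deg M(1,2) ne _ less.prems(3)]
      have "b > 0"
        by (rule bs(2)[of "{}"]) simp
      have "total_weight V (restrict_to M \<alpha> g) \<le> c + r * real (b - 1)" if "\<alpha> \<in> Pow M" for \<alpha>
        using that \<open>b > 0\<close> less.prems(1,2) assms(1) M(1)
        by (intro less.IH boolean_on_restrict_to degree_le_restrict_to bs(1)) auto
      then have "(\<Sum>\<alpha>\<in>Pow M. total_weight V (restrict_to M \<alpha> g)) \<le> (\<Sum>\<alpha>\<in>Pow M. c + r * real (b - 1))"
        by (rule sum_mono)
      also have "\<dots> = 2 ^ card M * (c + r * real (b - 1))"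
        using finite_subset[OF M(1) assms(1)] by (simp add: card_Pow)
      finally have "(1/2) ^ card M * (\<Sum>\<alpha>\<in>Pow M. total_weight V (restrict_to M \<alpha> g))
          \<le> (1/2) ^ card M * (2 ^ card M * (c + r * real (b - 1)))"
        by (intro mult_left_mono) auto
      also have "\<dots> = c + r * real (b - 1)"
        by (simp add: power_one_over)
      finally have "total_weight V g \<le> r + (c + r * real (b - 1))"
        using total_weight_restrict_to[OF assms(1) M(1,2)] assms(3) unfolding card by linarith
      also have "\<dots> = c + r * real b"
        using \<open>b > 0\<close> by (simp add: of_nat_diff algebra_simps)
      finally show ?thesis .
    qed
  qed
  then show ?thesis
    by (simp add: weight_line_def)
qed

text \<open>The slope $d/2^d$ is the cost of fixing one monomial of degree $d$, which lowers the block
  sensitivity by one. The new line is the convex combination of the old line and the constant $m$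
  whose slope is $(d+1)/2^{d+1}$.\<close>
lemma weight_line_advance:
  assumes "finite V" "weight_line V d c (real d / 2 ^ d)" "weight_max V d m" "1 \<le> d"
    and "m + (real d + 1) / (2 * real d) * (c - m) \<le> c'"
  shows "weight_line V (Suc d) c' (real (Suc d) / 2 ^ Suc d)"
proof (rule weight_line_Suc[OF assms(1)])
  define t where "t = (real d + 1) / (2 * real d)"
  have t: "0 \<le> t" "t \<le> 1"
    using assms(4) by (simp_all add: t_def)
  show "weight_line V d c' (real (Suc d) / 2 ^ Suc d)"
    unfolding weight_line_def
  proof (intro allI impI)
    fix g b assume g: "boolean_on V g" "degree_le V d g" "block_sensitivity_le V b g"
    define w where "w = total_weight V g"
    have "w \<le> c + real d / 2 ^ d * real b" "w \<le> m"
      using assms(2,3) g by (simp_all add: weight_line_def weight_max_def w_def)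
    then have "t * w + (1 - t) * w \<le> t * (c + real d / 2 ^ d * real b) + (1 - t) * m"
      using t by (intro add_mono mult_left_mono) auto
    moreover have slope: "t * (real d / 2 ^ d) = real (Suc d) / 2 ^ Suc d"
      using assms(4) by (simp add: t_def field_simps)
    have "t * (c + real d / 2 ^ d * real b) = t * c + t * (real d / 2 ^ d) * real b"
      by (simp only: distrib_left mult.assoc)
    then have "t * (c + real d / 2 ^ d * real b) = t * c + real (Suc d) / 2 ^ Suc d * real b"
      by (simp only: slope)
    ultimately show "total_weight V g \<le> c' + real (Suc d) / 2 ^ Suc d * real b"
      using assms(5) unfolding w_def[symmetric] t_def[symmetric] by (simp add: algebra_simps)
  qed
qed simp

section \<open>Numerical evaluation of the recursion\<close>

lemma weight_max_mono: "weight_max V d m \<Longrightarrow> m \<le> m' \<Longrightarrow> weight_max V d m'"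
  unfolding weight_max_def by force

text \<open>The maximum used for advancing from degree \<open>d\<close> is \<open>d / 2\<close> for
  \<open>d < 8\<close> and comes from the step bounds for \<open>d\<close> from 8 to 20. Each
  intercept is the outcome of \<open>weight_line_advance\<close>, rounded up; in degree 21 the
  quadratic bound closes the chain.\<close>

lemma weight_max_21:
  assumes fin: "finite V"
  shows "weight_max V 21 4.402392"
proof -
  note half = weight_line_advance[OF fin _ weight_max_half[OF fin]]
  have line_half: "weight_line V d' c' (real d' / 2 ^ d')"
    if "weight_line V d c (real d / 2 ^ d)" "d' = Suc d" "1 \<le> d"
      "real d / 2 + (real d + 1) / (2 * real d) * (c - real d / 2) \<le> c'" for d d' c c'
    using half[OF that(1,3,4)] that(2) by simp
  have line: "weight_line V d' c' (real d' / 2 ^ d')"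
    if "step_bound d B" "weight_line V d c (real d / 2 ^ d)" "d' = Suc d" "1 \<le> d"
      "c + real d / 2 ^ d * real B + (real d + 1) / (2 * real d) * (c - (c + real d / 2 ^ d * real B)) \<le> c'"
    for B d d' c c'
    using weight_line_advance[OF fin that(2) weight_max_of_line[OF fin that(2,1)] that(4,5)] that(3) by simp
  \<comment> \<open>In degree 0 all weights vanish, so the line of slope 1/2 through the origin
    holds there and carries over to degree 1.\<close>
  have "weight_line V 1 0 (real 1 / 2 ^ 1)"
    using weight_line_Suc[OF fin, of 0 0 "1/2"] weight_line_of_max[OF weight_max_half[OF fin, of 0], of "1/2"] by simp
  then have "weight_line V 2 0 (real 2 / 2 ^ 2)"
    by (rule line_half) simp_all
  then have "weight_line V 3 0.25 (real 3 / 2 ^ 3)"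
    by (rule line_half) simp_all
  then have "weight_line V 4 0.666667 (real 4 / 2 ^ 4)"
    by (rule line_half) simp_all
  then have "weight_line V 5 1.166667 (real 5 / 2 ^ 5)"
    by (rule line_half) simp_all
  then have "weight_line V 6 1.700001 (real 6 / 2 ^ 6)"
    by (rule line_half) simp_all
  then have "weight_line V 7 2.241668 (real 7 / 2 ^ 7)"
    by (rule line_half) simp_all
  then have "weight_line V 8 2.780954 (real 8 / 2 ^ 8)"
    by (rule line_half) simp_all
  then have "weight_line V 9 3.300486 (real 9 / 2 ^ 9)"
    by (rule line[OF step_bound_8]) simp_all
  then have "weight_line V 10 3.667674 (real 10 / 2 ^ 10)"
    by (rule line[OF step_bound_9]) simp_all
  then have "weight_line V 11 3.922558 (real 11 / 2 ^ 11)"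
    by (rule line[OF step_bound_10]) simp_all
  then have "weight_line V 12 4.095898 (real 12 / 2 ^ 12)"
    by (rule line[OF step_bound_11]) simp_all
  then have "weight_line V 13 4.208692 (real 13 / 2 ^ 13)"
    by (rule line[OF step_bound_12]) simp_all
  then have "weight_line V 14 4.281202 (real 14 / 2 ^ 14)"
    by (rule line[OF step_bound_13]) simp_all
  then have "weight_line V 15 4.32643 (real 15 / 2 ^ 15)"
    by (rule line[OF step_bound_14]) simp_all
  then have "weight_line V 16 4.354416 (real 16 / 2 ^ 16)"
    by (rule line[OF step_bound_15]) simp_all
  then have "weight_line V 17 4.371468 (real 17 / 2 ^ 17)"
    by (rule line[OF step_bound_16]) simp_all
  then have "weight_line V 18 4.381723 (real 18 / 2 ^ 18)"
    by (rule line[OF step_bound_17]) simp_all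
  then have "weight_line V 19 4.387852 (real 19 / 2 ^ 19)"
    by (rule line[OF step_bound_18]) simp_all
  then have "weight_line V 20 4.391458 (real 20 / 2 ^ 20)"
    by (rule line[OF step_bound_19]) simp_all
  then have "weight_line V 21 4.39357 (real 21 / 2 ^ 21)"
    by (rule line[OF step_bound_20]) simp_all
  from weight_max_of_line[OF fin this step_bound_quadratic] show ?thesis
    by (rule weight_max_mono) simp_all
qed

text \<open>The subtracted term is $2\sum_{j>d} j^3 2^{-j}$.\<close>
lemma weight_max_tail:
  assumes "finite V" "21 \<le> d"
  shows "weight_max V d (4.416 - 2 * ((real d) ^ 3 + 6 * (real d)\<^sup>2 + 18 * real d + 26) / 2 ^ d)"
  using assms(2)
proof (induction d rule: dec_induct)
  case base
  show ?case
    by (rule weight_max_mono[OF weight_max_21[OF assms(1)]]) simp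
next
  case (step d)
  define x where "x = real (Suc d)"
  define m where "m = 4.416 - 2 * ((real d) ^ 3 + 6 * (real d)\<^sup>2 + 18 * real d + 26) / 2 ^ d"
  \<comment> \<open>The previous maximum serves as intercept. The new degree then costs at most 2
    x^3 / 2^x, which is exactly the first term of the remaining tail.\<close>
  have "weight_line V d m (x / 2 ^ Suc d)"
    using step.IH by (intro weight_line_of_max) (simp_all add: m_def x_def)
  then have "weight_line V (Suc d) m (x / 2 ^ Suc d)"
    by (intro weight_line_Suc assms) (simp_all add: x_def)
  then have max: "weight_max V (Suc d) (m + x / 2 ^ Suc d * real (2 * (Suc d)\<^sup>2 - 1))"
    by (rule weight_max_of_line[OF assms(1)]) (rule step_bound_quadratic, simp)
  have "real (2 * (Suc d)\<^sup>2 - 1) \<le> 2 * x\<^sup>2"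
    using of_nat_mono[of "2 * (Suc d)\<^sup>2 - 1" "2 * (Suc d)\<^sup>2", where ?'a = real] by (simp add: x_def)
  then have "x / 2 ^ Suc d * real (2 * (Suc d)\<^sup>2 - 1) \<le> x / 2 ^ Suc d * (2 * x\<^sup>2)"
    by (intro mult_left_mono) (simp_all add: x_def)
  moreover have "m + x / 2 ^ Suc d * (2 * x\<^sup>2) = 4.416 - 2 * (x ^ 3 + 6 * x\<^sup>2 + 18 * x + 26) / 2 ^ Suc d"
  proof -
    have x: "x = real d + 1"
      by (simp add: x_def)
    show ?thesis
      unfolding m_def x by (simp add: field_simps power2_eq_square power3_eq_cube)
  qed
  ultimately show ?case
    unfolding x_def[symmetric] by (intro weight_max_mono[OF max]) linarith
qed

lemma total_weight_le:
  assumes "finite V" "boolean_on V g" "degree_le V d g"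
  shows "total_weight V g \<le> 4.416"
proof -
  define e where "e = max d 21"
  have e: "d \<le> e" "21 \<le> e"
    by (simp_all add: e_def)
  have "degree_le V e g"
    using assms(3) e(1) unfolding degree_le_def by (meson order_trans)
  then have "total_weight V g \<le> 4.416 - 2 * ((real e) ^ 3 + 6 * (real e)\<^sup>2 + 18 * real e + 26) / 2 ^ e"
    using weight_max_tail[OF assms(1) e(2)] assms(2) unfolding weight_max_def by blast
  moreover have "0 \<le> 2 * ((real e) ^ 3 + 6 * (real e)\<^sup>2 + 18 * real e + 26) / 2 ^ e"
    by (intro divide_nonneg_nonneg mult_nonneg_nonneg add_nonneg_nonneg) simp_all
  ultimately show ?thesis
    by linarith
qed

subsection \<open>Relevant variables\<close>

definition cube_fun :: "((nat \<Rightarrow> bool) \<Rightarrow> bool) \<Rightarrow> nat set \<Rightarrow> real" where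
  "cube_fun f A = of_bool (f (\<lambda>i. i \<in> A))"

text \<open>At the indicator of \<open>A\<close> a monomial \<open>S\<close> has value 1 if
  \<open>S \<subseteq> A\<close> and 0 otherwise, so the values of \<open>f\<close> are subset sums
  of \<open>c\<close>. Moebius inversion then yields existence and uniqueness at once.\<close>

lemma multilinear_rep_iff:
  "multilinear_rep n f c \<longleftrightarrow> c = (\<lambda>S. if S \<subseteq> {0..<n} then coef (cube_fun f) S else 0)"
proof -
  have eval: "(\<Sum>S\<in>Pow {0..<n}. c S * (\<Prod>i\<in>S. of_bool (i \<in> A))) = (\<Sum>S\<in>Pow A. c S)"
    if "A \<subseteq> {0..<n}" for A and c :: "nat set \<Rightarrow> real"
  proof (rule sum.mono_neutral_cong_right)
    show "Pow A \<subseteq> Pow {0..<n}"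
      using that by (rule Pow_mono)
    show "\<forall>S\<in>Pow {0..<n} - Pow A. c S * (\<Prod>i\<in>S. of_bool (i \<in> A)) = 0"
    proof
      fix S assume S: "S \<in> Pow {0..<n} - Pow A"
      then have "finite S"
        using finite_subset[of S "{0..<n}"] by simp
      moreover have "\<exists>i\<in>S. of_bool (i \<in> A) = (0::real)"
        using S by auto
      ultimately have "(\<Prod>i\<in>S. of_bool (i \<in> A)) = (0::real)"
        by (rule prod_zero)
      then show "c S * (\<Prod>i\<in>S. of_bool (i \<in> A)) = 0"
        by simp
    qed
    show "c S * (\<Prod>i\<in>S. of_bool (i \<in> A)) = c S" if "S \<in> Pow A" for S
      using that by (simp add: prod.neutral subset_iff)
  qed simp
  have "(\<forall>x\<in>cube n. of_bool (f x) = (\<Sum>S\<in>Pow {0..<n}. c S * (\<Prod>i\<in>S. of_bool (x i))))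
      \<longleftrightarrow> (\<forall>A\<subseteq>{0..<n}. cube_fun f A = (\<Sum>S\<in>Pow A. c S))"
  proof (intro iffI allI impI ballI)
    fix A :: "nat set"
    assume *: "\<forall>x\<in>cube n. of_bool (f x) = (\<Sum>S\<in>Pow {0..<n}. c S * (\<Prod>i\<in>S. of_bool (x i)))"
      and A: "A \<subseteq> {0..<n}"
    have "(\<lambda>i. i \<in> A) \<in> cube n"
      using A by (auto simp: cube_def)
    then show "cube_fun f A = (\<Sum>S\<in>Pow A. c S)"
      using bspec[OF *, of "\<lambda>i. i \<in> A"] eval[OF A, of c] by (simp add: cube_fun_def)
  next
    fix x assume *: "\<forall>A\<subseteq>{0..<n}. cube_fun f A = (\<Sum>S\<in>Pow A. c S)" and x: "x \<in> cube n"
    have A: "{i. x i} \<subseteq> {0..<n}"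
      using x by (auto simp: cube_def intro: ccontr)
    then have "cube_fun f {i. x i} = (\<Sum>S\<in>Pow {i. x i}. c S)"
      using * by blast
    then show "of_bool (f x) = (\<Sum>S\<in>Pow {0..<n}. c S * (\<Prod>i\<in>S. of_bool (x i)))"
      using eval[OF A, of c] by (simp add: cube_fun_def)
  qed
  also have "\<dots> \<longleftrightarrow> (\<forall>S\<subseteq>{0..<n}. coef (cube_fun f) S = c S)"
  proof (intro iffI allI impI)
    fix S assume "\<forall>A\<subseteq>{0..<n}. cube_fun f A = (\<Sum>S\<in>Pow A. c S)" "S \<subseteq> {0..<n}"
    then show "coef (cube_fun f) S = c S"
      by (intro coef_unique[of "{0..<n}"]) simp_all
  next
    fix A assume *: "\<forall>S\<subseteq>{0..<n}. coef (cube_fun f) S = c S" and A: "A \<subseteq> {0..<n}"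
    have "cube_fun f A = (\<Sum>S\<in>Pow A. coef (cube_fun f) S)"
      using finite_subset[OF A] by (simp add: moebius_inversion)
    also have "\<dots> = (\<Sum>S\<in>Pow A. c S)"
    proof (rule sum.cong)
      fix S assume "S \<in> Pow A"
      then have "S \<subseteq> {0..<n}"
        using A by blast
      then show "coef (cube_fun f) S = c S"
        using * by blast
    qed simp
    finally show "cube_fun f A = (\<Sum>S\<in>Pow A. c S)" .
  qed
  finally show ?thesis
    unfolding multilinear_rep_def fun_eq_iff by (auto split: if_splits)
qed

lemma ml_coeffs_eq: "ml_coeffs n f = (\<lambda>S. if S \<subseteq> {0..<n} then coef (cube_fun f) S else 0)"
  unfolding ml_coeffs_def multilinear_rep_iff by (rule the_equality) simp_all

lemma degree_le_bool_deg: "degree_le {0..<n} (bool_deg n f) (cube_fun f)"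
  unfolding degree_le_def
proof (intro allI impI)
  fix S assume S: "S \<subseteq> {0..<n}" "coef (cube_fun f) S \<noteq> 0"
  have "finite {card S | S. S \<subseteq> {0..<n} \<and> ml_coeffs n f S \<noteq> 0}"
    by (rule finite_subset[of _ "card ` Pow {0..<n}"]) auto
  moreover have "card S \<in> {card S | S. S \<subseteq> {0..<n} \<and> ml_coeffs n f S \<noteq> 0}"
    using S by (auto simp: ml_coeffs_eq)
  ultimately show "card S \<le> bool_deg n f"
    unfolding bool_deg_def by (intro Max_ge) simp_all
qed

text \<open>A sensitive input makes the derivative nonzero, so it has a largest monomial
  \<open>S\<close>. Then \<open>insert i S\<close> is a monomial of \<open>f\<close>, and
  \<open>card S\<close> is at most the degree minus one.\<close>

lemma degree_weight_ge_if_relevant: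
  assumes "relevant n f i"
  shows "2 / 2 ^ bool_deg n f \<le> degree_weight {0..<n} (deriv_at i (cube_fun f))"
proof -
  obtain x where i: "i < n" and x: "x \<in> cube n" "f (x(i := \<not> x i)) \<noteq> f x"
    using assms by (auto simp: relevant_def)
  define A where "A = {j. x j}"
  have A: "A \<subseteq> {0..<n}"
    using x(1) by (auto simp: A_def cube_def intro: ccontr)
  have ins: "(\<lambda>j. j \<in> insert i A) = x(i := True)" and del: "(\<lambda>j. j \<in> A - {i}) = x(i := False)"
    by (simp_all add: A_def fun_eq_iff)
  have "f (x(i := True)) \<noteq> f (x(i := False))"
  proof (cases "x i")
    case True
    then have "x(i := True) = x"
      by (simp add: fun_upd_idem)
    then show ?thesis
      using x(2) True by simp
  next
    case False
    then have "x(i := False) = x"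
      by (simp add: fun_upd_idem)
    then show ?thesis
      using x(2) False by simp
  qed
  then have "deriv_at i (cube_fun f) A \<noteq> 0"
    unfolding deriv_at_def cube_fun_def ins del by (simp add: of_bool_def)
  then have "(\<Sum>S\<in>Pow A. coef (deriv_at i (cube_fun f)) S) \<noteq> 0"
    using finite_subset[OF A] by (simp add: moebius_inversion)
  then obtain T where "T \<subseteq> A" "coef (deriv_at i (cube_fun f)) T \<noteq> 0"
    by (rule sum.not_neutral_contains_not_neutral) simp
  then have "\<not> (\<forall>S\<subseteq>{0..<n}. coef (deriv_at i (cube_fun f)) S = 0)"
    using subset_trans[OF _ A] by blast
  then obtain S where S: "S \<subseteq> {0..<n}" "coef (deriv_at i (cube_fun f)) S \<noteq> 0"
    "degree_weight {0..<n} (deriv_at i (cube_fun f)) = (1/2) ^ card S"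
    "degree_le {0..<n} (card S) (deriv_at i (cube_fun f))"
    by (rule degree_weight_attained[OF finite_atLeastLessThan])
  have fin: "finite S"
    using finite_subset[OF S(1)] by simp
  have "i \<notin> S" "coef (cube_fun f) (insert i S) \<noteq> 0"
    using S(2) coef_deriv_at[OF fin, of i "cube_fun f"] by (simp_all split: if_splits)
  moreover have "insert i S \<subseteq> {0..<n}"
    using S(1) i by simp
  ultimately have "card (insert i S) \<le> bool_deg n f"
    using degree_le_bool_deg[of n f] unfolding degree_le_def by blast
  then have "Suc (card S) \<le> bool_deg n f"
    using \<open>i \<notin> S\<close> fin by simp
  then have "(1/2::real) ^ bool_deg n f \<le> (1/2) ^ Suc (card S)"
    by (intro power_decreasing) auto
  then show ?thesis
    unfolding S(3) by (simp add: power_one_over)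
qed

theorem theorem3:
  fixes n d :: nat and f :: "(nat \<Rightarrow> bool) \<Rightarrow> bool"
  assumes "n \<ge> 1" and "bool_deg n f = d"
  shows "real (card {i. relevant n f i}) \<le> 4.416 * 2 ^ d"
proof -
  define R where "R = {i. relevant n f i}"
  define w where "w i = degree_weight {0..<n} (deriv_at i (cube_fun f))" for i
  have R: "R \<subseteq> {0..<n}"
    by (auto simp: R_def relevant_def)
  \<comment> \<open>Each relevant variable adds at least \<open>2 / 2 ^ d\<close> to a sum of
    nonnegative weights that equals twice the total weight.\<close>
  have "real (card R) * (2 / 2 ^ d) = (\<Sum>i\<in>R. 2 / 2 ^ d)"
    by simp
  also have "\<dots> \<le> (\<Sum>i\<in>R. w i)"
    unfolding w_def using assms(2) degree_weight_ge_if_relevant by (intro sum_mono) (auto simp: R_def)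
  also have "\<dots> \<le> (\<Sum>i\<in>{0..<n}. w i)"
    unfolding w_def using R by (intro sum_mono2 degree_weight_nonneg) simp_all
  also have "\<dots> = 2 * total_weight {0..<n} (cube_fun f)"
    by (simp add: total_weight_def w_def)
  also have "\<dots> \<le> 2 * 4.416"
  proof -
    have "boolean_on {0..<n} (cube_fun f)"
      by (simp add: boolean_on_def cube_fun_def)
    from total_weight_le[OF finite_atLeastLessThan this degree_le_bool_deg] show ?thesis
      by simp
  qed
  finally show ?thesis
    unfolding R_def by (simp add: field_simps)
qed

end
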